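(* Let $r\colon D\otimes D\to D\otimes D$ be a non-degenerate coalgebra automorphism that induces a non-degenerate solution $r_0\colon X\times X\to X\times X$ of the set-theoretic braid equation. Then $r$ is a solution of the braid equation if and only if $\mathrm{LBE}(S,T)=\mathrm{RBE}(S,T)$ holds for all $S\subseteq T$ such that either $S\subseteq T$ is lower extremal with $\mathfrak{h}(T)\ge 1$, or $S=T$ and $\mathfrak{h}(T)=1$.
   Context: $K$ is a field and $(X,\le)$ is a locally finite poset (each closed interval $[a,b]=\{c: a\le c\le b\}$ is finite). Put $Y=\{(a,b)\in X\times X: a\le b\}$, and let $D=KY$ be the incidence coalgebra (vector space with basis $Y$), with $\Delta(a,b)=\sum_{c\in[a,b]}(a,c)\otimes(c,b)$ and $\epsilon(a,b)=\delta_{ab}$. Tensor products are over $K$ and $D\otimes D$ has the tensor product coalgebra structure. Each $a\in X$ is identified with $(a,a)\in D$, and $X\times X$ with $\{a\otimes c: a,c\in X\}\subseteq D\otimes D$. The height of a chain $c_0<\dots<c_n$ is $n$; the height $\mathfrak h(P)$ of a finite poset $P$ is the height of its largest chain. Non-degeneracy: a coalgebra automorphism $r$ of $D\otimes D$ is non-degenerate if, with $\sigma=(\mathrm{id}_D\otimes\epsilon)\circ r$ and $\tau=(\epsilon\otimes \mathrm{id}_D)\circ r$, the maps $(\mathrm{id}_D\otimes\sigma)\circ(\Delta\otimes \mathrm{id}_D)$ and $(\tau\otimes \mathrm{id}_D)\circ(\mathrm{id}_D\otimes\Delta)$ are isomorphisms. Such an $r$ restricts to a bijection $r_0$ of $X\times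 X$; write $r_0(a,b)=({}^a b,a^b)$. The map $r_0$ is non-degenerate if all maps ${}^a(-)$ and $(-)^b$ from $X$ to $X$ are bijective. The map $r$ (resp. $r_0$) is a solution of the braid equation if $r_{12}r_{23}r_{12}=r_{23}r_{12}r_{23}$ on $D^{\otimes 3}$ (resp. the same for $r_0$ on $X^3$). Coefficients: for $a\le b$, $c\le d$, $r((a,b)\otimes(c,d))=\sum_{e\le f}\sum_{g\le h}\lambda_{a|b|c|d}^{e|f|g|h}(e,f)\otimes(g,h)$. Intervals: $X\times X\times X$ has the product order. For $(a,b),(c,d),(e,f),(g,h),(i,j),(k,l)\in Y$ let $T=[a,b]\times[c,d]\times[e,f]$ and $S=[g,h]\times[i,j]\times[k,l]$. For $S\subseteq T$ define $$\mathrm{LBE}(S,T)=\sum_{\substack{x\in[a,g]\\ y\in[h,b]}}\sum_{\substack{w\in[c,i]\\ z\in[j,d]}}\sum_{\substack{u\in[e,k]\\ v\in[l,f]}}\lambda_{a|b|c|d}^{{}^a w|{}^a z|x^c|y^c}\;\lambda_{x^c|y^c|e|f}^{{}^{x^c}u|{}^{x^c}v|(g^c)^e|(h^c)^e}\;\lambda_{{}^a w|{}^a z|{}^{x^c}u|{}^{x^c}v}^{{}^a({}^c k)|{}^a({}^c l)|({}^a i)^{({}^{a^i}e)}|({}^a j)^{({}^{a^j}e)}},$$ $$\mathrm{RBE}(S,T)=\sum_{\substack{x\in[a,g]\\ y\in[h,b]}}\sum_{\substack{w\in[c,i]\\ z\in[j,d]}}\sum_{\substack{u\in[e,k]\\ v\in[l,f]}}\lambda_{c|d|e|f}^{{}^c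 u|{}^c v|w^e|z^e}\;\lambda_{a|b|{}^c u|{}^c v}^{{}^a({}^c k)|{}^a({}^c l)|x^{({}^c u)}|y^{({}^c u)}}\;\lambda_{x^{({}^c u)}|y^{({}^c u)}|w^e|z^e}^{{}^{p}(i^e)|{}^{q}(j^e)|(g^c)^e|(h^c)^e},$$ where $p=a^{({}^i e)}$ and $q=a^{({}^j e)}$. An inclusion of intervals $[\alpha,\beta]\subseteq[\gamma,\delta]$ with $\gamma<\delta$ is lower extremal if $\alpha=\beta=\gamma$; for $S\subseteq T$ this is understood in $X\times X\times X$, i.e. $S=\{(a,c,e)\}$ is the least element of $T$ and $T$ is not a single point. *)

theory Defs
  imports Complex_Main "HOL-Library.Poly_Mapping" "HOL-Library.Product_Order"
begin

section \<open>Free vector spaces and their tensor products\<close>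

text \<open>
  The vector space over \<open>'k\<close> with basis \<open>'b\<close> is the type \<open>'b \<Rightarrow>\<^sub>0 'k\<close> of finitely supported
  functions. The tensor product of the spaces with bases \<open>'b\<close> and \<open>'c\<close> is the space with basis
  \<open>'b \<times> 'c\<close>, where \<open>basis (b, c)\<close> is the pure tensor of \<open>basis b\<close> and \<open>basis c\<close>. A tensor product
  with the ground field is identified with the other factor.
\<close>

definition fscale :: "'k::field \<Rightarrow> ('b \<Rightarrow>\<^sub>0 'k) \<Rightarrow> ('b \<Rightarrow>\<^sub>0 'k)" where
  "fscale c p = Poly_Mapping.map ((*) c) p"

lemma lookup_fscale [simp]:
  "Poly_Mapping.lookup (fscale c p) b = c * Poly_Mapping.lookup p b"
  by (simp add: fscale_def Poly_Mapping.map.rep_eq when_def)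

lemma vector_space_fscale: "vector_space fscale"
  by unfold_locales (auto intro!: poly_mapping_eqI simp: lookup_add algebra_simps)

definition basis :: "'b \<Rightarrow> ('b \<Rightarrow>\<^sub>0 'k::field)" where
  "basis b = Poly_Mapping.single b 1"

definition lin_ext :: "('b \<Rightarrow> ('c \<Rightarrow>\<^sub>0 'k)) \<Rightarrow> ('b \<Rightarrow>\<^sub>0 'k::field) \<Rightarrow> ('c \<Rightarrow>\<^sub>0 'k)" where
  "lin_ext \<phi> p = (\<Sum>b\<in>Poly_Mapping.keys p. fscale (Poly_Mapping.lookup p b) (\<phi> b))"

definition lin_form :: "('b \<Rightarrow> 'k) \<Rightarrow> ('b \<Rightarrow>\<^sub>0 'k::field) \<Rightarrow> 'k" where
  "lin_form \<phi> p = (\<Sum>b\<in>Poly_Mapping.keys p. Poly_Mapping.lookup p b * \<phi> b)"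

definition tensor :: "('b \<Rightarrow>\<^sub>0 'k::field) \<Rightarrow> ('c \<Rightarrow>\<^sub>0 'k) \<Rightarrow> ('b \<times> 'c \<Rightarrow>\<^sub>0 'k)" where
  "tensor p q = lin_ext (\<lambda>b. lin_ext (\<lambda>c. basis (b, c)) q) p"

definition tensor_map ::
    "(('b \<Rightarrow>\<^sub>0 'k) \<Rightarrow> ('d \<Rightarrow>\<^sub>0 'k)) \<Rightarrow> (('c \<Rightarrow>\<^sub>0 'k) \<Rightarrow> ('e \<Rightarrow>\<^sub>0 'k)) \<Rightarrow>
     ('b \<times> 'c \<Rightarrow>\<^sub>0 'k::field) \<Rightarrow> ('d \<times> 'e \<Rightarrow>\<^sub>0 'k)" where
  "tensor_map f g = lin_ext (\<lambda>(b, c). tensor (f (basis b)) (g (basis c)))"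

definition id_tensor_form :: "(('c \<Rightarrow>\<^sub>0 'k) \<Rightarrow> 'k) \<Rightarrow> ('b \<times> 'c \<Rightarrow>\<^sub>0 'k::field) \<Rightarrow> ('b \<Rightarrow>\<^sub>0 'k)" where
  "id_tensor_form \<epsilon> = lin_ext (\<lambda>(b, c). fscale (\<epsilon> (basis c)) (basis b))"

definition form_tensor_id :: "(('b \<Rightarrow>\<^sub>0 'k) \<Rightarrow> 'k) \<Rightarrow> ('b \<times> 'c \<Rightarrow>\<^sub>0 'k::field) \<Rightarrow> ('c \<Rightarrow>\<^sub>0 'k)" where
  "form_tensor_id \<epsilon> = lin_ext (\<lambda>(b, c). fscale (\<epsilon> (basis b)) (basis c))"

text \<open>Triple tensor products are nested to the right.\<close>

definition assoc_r :: "(('b \<times> 'c) \<times> 'd \<Rightarrow>\<^sub>0 'k::field) \<Rightarrow> ('b \<times> 'c \<times> 'd \<Rightarrow>\<^sub>0 'k)" where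
  "assoc_r = lin_ext (\<lambda>((b, c), d). basis (b, c, d))"

definition assoc_l :: "('b \<times> 'c \<times> 'd \<Rightarrow>\<^sub>0 'k::field) \<Rightarrow> (('b \<times> 'c) \<times> 'd \<Rightarrow>\<^sub>0 'k)" where
  "assoc_l = lin_ext (\<lambda>(b, c, d). basis ((b, c), d))"

definition linear_iso :: "(('b \<Rightarrow>\<^sub>0 'k::field) \<Rightarrow> ('c \<Rightarrow>\<^sub>0 'k)) \<Rightarrow> bool" where
  "linear_iso f \<longleftrightarrow> Vector_Spaces.linear fscale fscale f \<and> bij f"

section \<open>Coalgebra automorphisms\<close>

definition coalgebra_automorphism ::
    "(('b \<Rightarrow>\<^sub>0 'k) \<Rightarrow> ('b \<times> 'b \<Rightarrow>\<^sub>0 'k)) \<Rightarrow> (('b \<Rightarrow>\<^sub>0 'k) \<Rightarrow> 'k) \<Rightarrow>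
     (('b \<Rightarrow>\<^sub>0 'k::field) \<Rightarrow> ('b \<Rightarrow>\<^sub>0 'k)) \<Rightarrow> bool" where
  "coalgebra_automorphism \<Delta> \<epsilon> f \<longleftrightarrow>
     linear_iso f \<and> tensor_map f f \<circ> \<Delta> = \<Delta> \<circ> f \<and> \<epsilon> \<circ> f = \<epsilon>"

text \<open>The comultiplication \<open>(id \<otimes> flip \<otimes> id) \<circ> (\<Delta> \<otimes> \<Delta>)\<close> and the counit
  \<open>\<epsilon> \<otimes> \<epsilon>\<close> of the tensor square of a coalgebra.\<close>

definition comult_sq ::
    "(('b \<Rightarrow>\<^sub>0 'k) \<Rightarrow> ('b \<times> 'b \<Rightarrow>\<^sub>0 'k)) \<Rightarrow>
     ('b \<times> 'b \<Rightarrow>\<^sub>0 'k::field) \<Rightarrow> (('b \<times> 'b) \<times> ('b \<times> 'b) \<Rightarrow>\<^sub>0 'k)" where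
  "comult_sq \<Delta> =
     lin_ext (\<lambda>((b, b'), (c, c')). basis ((b, c), (b', c'))) \<circ> tensor_map \<Delta> \<Delta>"

definition counit_sq :: "(('b \<Rightarrow>\<^sub>0 'k) \<Rightarrow> 'k) \<Rightarrow> ('b \<times> 'b \<Rightarrow>\<^sub>0 'k::field) \<Rightarrow> 'k" where
  "counit_sq \<epsilon> = lin_form (\<lambda>(b, c). \<epsilon> (basis b) * \<epsilon> (basis c))"

section \<open>The incidence coalgebra\<close>

text \<open>\<open>'x ival\<close> is the set \<open>Y\<close> of pairs \<open>(a, b)\<close> with \<open>a \<le> b\<close>.\<close>

typedef (overloaded) ('x::order) ival = "{p :: 'x \<times> 'x. fst p \<le> snd p}"
  by auto

definition ival :: "'x::order \<Rightarrow> 'x \<Rightarrow> 'x ival" where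
  "ival a b = Abs_ival (a, b)"

definition lo :: "'x::order ival \<Rightarrow> 'x" where
  "lo i = fst (Rep_ival i)"

definition hi :: "'x::order ival \<Rightarrow> 'x" where
  "hi i = snd (Rep_ival i)"

lemma lo_ival [simp]: "a \<le> b \<Longrightarrow> lo (ival a b) = a"
  and hi_ival [simp]: "a \<le> b \<Longrightarrow> hi (ival a b) = b"
  by (simp_all add: lo_def hi_def ival_def Abs_ival_inverse)

type_synonym ('x, 'k) inc = "'x ival \<Rightarrow>\<^sub>0 'k"
type_synonym ('x, 'k) inc2 = "'x ival \<times> 'x ival \<Rightarrow>\<^sub>0 'k"
type_synonym ('x, 'k) inc3 = "'x ival \<times> 'x ival \<times> 'x ival \<Rightarrow>\<^sub>0 'k"

definition comult :: "('x::order, 'k::field) inc \<Rightarrow> ('x, 'k) inc2" where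
  "comult = lin_ext (\<lambda>i. \<Sum>c\<in>{lo i..hi i}. basis (ival (lo i) c, ival c (hi i)))"

definition counit :: "('x::order, 'k::field) inc \<Rightarrow> 'k" where
  "counit = lin_form (\<lambda>i. if lo i = hi i then 1 else 0)"

section \<open>Non-degeneracy and the braid equation\<close>

definition sigma_part ::
    "(('x::order, 'k::field) inc2 \<Rightarrow> ('x, 'k) inc2) \<Rightarrow> ('x, 'k) inc2 \<Rightarrow> ('x, 'k) inc" where
  "sigma_part r = id_tensor_form counit \<circ> r"

definition tau_part ::
    "(('x::order, 'k::field) inc2 \<Rightarrow> ('x, 'k) inc2) \<Rightarrow> ('x, 'k) inc2 \<Rightarrow> ('x, 'k) inc" where
  "tau_part r = form_tensor_id counit \<circ> r"

definition nondegenerate ::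
    "(('x::order, 'k::field) inc2 \<Rightarrow> ('x, 'k) inc2) \<Rightarrow> bool" where
  "nondegenerate r \<longleftrightarrow>
     linear_iso (tensor_map id (sigma_part r) \<circ> assoc_r \<circ> tensor_map comult id) \<and>
     linear_iso (tensor_map (tau_part r) id \<circ> assoc_l \<circ> tensor_map id comult)"

definition r12 ::
    "(('x::order, 'k::field) inc2 \<Rightarrow> ('x, 'k) inc2) \<Rightarrow> ('x, 'k) inc3 \<Rightarrow> ('x, 'k) inc3" where
  "r12 r = assoc_r \<circ> tensor_map r id \<circ> assoc_l"

definition r23 ::
    "(('x::order, 'k::field) inc2 \<Rightarrow> ('x, 'k) inc2) \<Rightarrow> ('x, 'k) inc3 \<Rightarrow> ('x, 'k) inc3" where
  "r23 r = tensor_map id r"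

definition braid_solution ::
    "(('x::order, 'k::field) inc2 \<Rightarrow> ('x, 'k) inc2) \<Rightarrow> bool" where
  "braid_solution r \<longleftrightarrow> r12 r \<circ> r23 r \<circ> r12 r = r23 r \<circ> r12 r \<circ> r23 r"

definition set_nondegenerate :: "('x \<times> 'x \<Rightarrow> 'x \<times> 'x) \<Rightarrow> bool" where
  "set_nondegenerate s \<longleftrightarrow>
     (\<forall>a. bij (\<lambda>b. fst (s (a, b)))) \<and> (\<forall>b. bij (\<lambda>a. snd (s (a, b))))"

definition set_r12 :: "('x \<times> 'x \<Rightarrow> 'x \<times> 'x) \<Rightarrow> 'x \<times> 'x \<times> 'x \<Rightarrow> 'x \<times> 'x \<times> 'x" where
  "set_r12 s = (\<lambda>(a, b, c). (fst (s (a, b)), snd (s (a, b)), c))"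

definition set_r23 :: "('x \<times> 'x \<Rightarrow> 'x \<times> 'x) \<Rightarrow> 'x \<times> 'x \<times> 'x \<Rightarrow> 'x \<times> 'x \<times> 'x" where
  "set_r23 s = (\<lambda>(a, b, c). (a, s (b, c)))"

definition set_braid_solution :: "('x \<times> 'x \<Rightarrow> 'x \<times> 'x) \<Rightarrow> bool" where
  "set_braid_solution s \<longleftrightarrow>
     set_r12 s \<circ> set_r23 s \<circ> set_r12 s = set_r23 s \<circ> set_r12 s \<circ> set_r23 s"

section \<open>The induced set-theoretic map and the coefficients\<close>

text \<open>\<open>r0 r\<close> is the restriction of \<open>r\<close> to the elements \<open>(a, a) \<otimes> (c, c)\<close>. A coalgebra automorphism
  permutes these (they are the group-like elements of the tensor square), so the description below
  then denotes a unique element.\<close>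

definition pt :: "'x::order \<times> 'x \<Rightarrow> ('x, 'k::field) inc2" where
  "pt p = basis (ival (fst p) (fst p), ival (snd p) (snd p))"

definition r0 ::
    "(('x::order, 'k::field) inc2 \<Rightarrow> ('x, 'k) inc2) \<Rightarrow> 'x \<times> 'x \<Rightarrow> 'x \<times> 'x" where
  "r0 r p = (THE q. r (pt p) = pt q)"

text \<open>\<open>lact r a b\<close> is \<open>\<^sup>ab\<close> and \<open>ract r a b\<close> is \<open>a\<^sup>b\<close>.\<close>

definition lact :: "(('x::order, 'k::field) inc2 \<Rightarrow> ('x, 'k) inc2) \<Rightarrow> 'x \<Rightarrow> 'x \<Rightarrow> 'x" where
  "lact r a b = fst (r0 r (a, b))"

definition ract :: "(('x::order, 'k::field) inc2 \<Rightarrow> ('x, 'k) inc2) \<Rightarrow> 'x \<Rightarrow> 'x \<Rightarrow> 'x" where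
  "ract r a b = snd (r0 r (a, b))"

text \<open>\<open>coef r a b c d e f g h\<close> is the coefficient of \<open>(e, f) \<otimes> (g, h)\<close> in
  \<open>r ((a, b) \<otimes> (c, d))\<close>. It is meaningful only if all four pairs lie in \<open>Y\<close>; this is the case for
  every coefficient in \<open>LBE\<close> and \<open>RBE\<close> when \<open>r\<close> is a coalgebra automorphism and \<open>r0 r\<close> is a
  non-degenerate solution of the braid equation, because then \<open>lact r\<close> and \<open>ract r\<close> are monotone
  in each argument. The value 0 outside \<open>Y\<close> is a dummy.\<close>

definition coef ::
    "(('x::order, 'k::field) inc2 \<Rightarrow> ('x, 'k) inc2) \<Rightarrow>
     'x \<Rightarrow> 'x \<Rightarrow> 'x \<Rightarrow> 'x \<Rightarrow> 'x \<Rightarrow> 'x \<Rightarrow> 'x \<Rightarrow> 'x \<Rightarrow> 'k" where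
  "coef r a b c d e f g h =
     (if a \<le> b \<and> c \<le> d \<and> e \<le> f \<and> g \<le> h
      then Poly_Mapping.lookup (r (basis (ival a b, ival c d))) (ival e f, ival g h)
      else 0)"

section \<open>The two sides of the braid equation on intervals\<close>

text \<open>The arguments are the least and the greatest element of
  \<open>S = [g, h] \<times> [i, j] \<times> [k, l]\<close>, followed by those of \<open>T = [a, b] \<times> [c, d] \<times> [e, f]\<close>.\<close>

fun LBE ::
    "(('x::order, 'k::field) inc2 \<Rightarrow> ('x, 'k) inc2) \<Rightarrow>
     'x \<times> 'x \<times> 'x \<Rightarrow> 'x \<times> 'x \<times> 'x \<Rightarrow> 'x \<times> 'x \<times> 'x \<Rightarrow> 'x \<times> 'x \<times> 'x \<Rightarrow> 'k" where
  "LBE r (g, i, k) (h, j, l) (a, c, e) (b, d, f) =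
     (let L = lact r; R = ract r in
      \<Sum>x\<in>{a..g}. \<Sum>y\<in>{h..b}. \<Sum>w\<in>{c..i}. \<Sum>z\<in>{j..d}. \<Sum>u\<in>{e..k}. \<Sum>v\<in>{l..f}.
        coef r a b c d (L a w) (L a z) (R x c) (R y c) *
        coef r (R x c) (R y c) e f
          (L (R x c) u) (L (R x c) v) (R (R g c) e) (R (R h c) e) *
        coef r (L a w) (L a z) (L (R x c) u) (L (R x c) v)
          (L a (L c k)) (L a (L c l)) (R (L a i) (L (R a i) e)) (R (L a j) (L (R a j) e)))"

fun RBE ::
    "(('x::order, 'k::field) inc2 \<Rightarrow> ('x, 'k) inc2) \<Rightarrow>
     'x \<times> 'x \<times> 'x \<Rightarrow> 'x \<times> 'x \<times> 'x \<Rightarrow> 'x \<times> 'x \<times> 'x \<Rightarrow> 'x \<times> 'x \<times> 'x \<Rightarrow> 'k" where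
  "RBE r (g, i, k) (h, j, l) (a, c, e) (b, d, f) =
     (let L = lact r; R = ract r; p = R a (L i e); q = R a (L j e) in
      \<Sum>x\<in>{a..g}. \<Sum>y\<in>{h..b}. \<Sum>w\<in>{c..i}. \<Sum>z\<in>{j..d}. \<Sum>u\<in>{e..k}. \<Sum>v\<in>{l..f}.
        coef r c d e f (L c u) (L c v) (R w e) (R z e) *
        coef r a b (L c u) (L c v)
          (L a (L c k)) (L a (L c l)) (R x (L c u)) (R y (L c u)) *
        coef r (R x (L c u)) (R y (L c u)) (R w e) (R z e)
          (L p (R i e)) (L q (R j e)) (R (R g c) e) (R (R h c) e))"

section \<open>Heights and extremal inclusions\<close>

definition height :: "'p::order set \<Rightarrow> nat" where
  "height P = Max {n. \<exists>c :: nat \<Rightarrow> 'p. (\<forall>i\<le>n. c i \<in> P) \<and> (\<forall>i<n. c i < c (Suc i))}"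

text \<open>The inclusion of \<open>{\<alpha>..\<beta>}\<close> in \<open>{\<gamma>..\<delta>}\<close>, where \<open>\<alpha> \<le> \<beta>\<close>, is lower extremal.\<close>

definition lower_extremal :: "'p::order \<Rightarrow> 'p \<Rightarrow> 'p \<Rightarrow> 'p \<Rightarrow> bool" where
  "lower_extremal \<alpha> \<beta> \<gamma> \<delta> \<longleftrightarrow>
     {\<alpha>..\<beta>} \<subseteq> {\<gamma>..\<delta>} \<and> \<gamma> < \<delta> \<and> \<alpha> = \<beta> \<and> \<beta> = \<gamma>"

end

theory Submission
  imports Defs
begin

text \<open>
  The group-like elements of \<open>D \<otimes> D\<close> form the poset \<open>X \<times> X\<close>, and a coalgebra automorphism of an
  incidence coalgebra permutes them by an order automorphism \<open>\<phi>\<close>. In the coordinates given by \<open>\<phi>\<close> its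
  coefficients \<open>n a b c d\<close> (of \<open>(\<phi> c, \<phi> d)\<close> in the image of \<open>(a, b)\<close>) vanish unless \<open>a \<le> c \<le> d \<le> b\<close>,
  they are multiplicative at every point of \<open>[c, d]\<close>, and \<open>n a b c c\<close> sums to 0 over \<open>c \<in> [a, b]\<close> if
  \<open>a < b\<close>. Multiplicativity gives \<open>n a b c d = n a c c c * n c d c d * n d b d d\<close>; the middle factor is
  a product over covering pairs, the last one is lower extremal, and the vanishing sum determines the
  first from the lower extremal ones by induction. Both sides of the braid equation have such
  coefficients on \<open>X \<times> X \<times> X\<close> for the same \<open>\<phi>\<close>, so they agree once these two kinds of coefficients do.
  That they are \<open>LBE\<close> and \<open>RBE\<close> uses that \<open>\<^sup>ab\<close> and \<open>b\<^sup>a\<close> depend only on \<open>b\<close> and the connected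
  component of \<open>a\<close>.
\<close>

section \<open>Linear maps on free vector spaces\<close>

lemma lookup_basis: "Poly_Mapping.lookup (basis b) c = (if b = c then 1 else 0)"
  by (simp add: basis_def lookup_single when_def)

lemma keys_basis [simp]: "Poly_Mapping.keys (basis b :: _ \<Rightarrow>\<^sub>0 'k::field) = {b}"
  by (simp add: basis_def)

text \<open>Terms outside the keys have coefficient 0. Allowing any finite \<open>A\<close> above
  the keys lets images of different elements be expanded over one index set.\<close>

lemma lookup_lin_ext:
  assumes "finite A" "Poly_Mapping.keys p \<subseteq> A"
  shows "Poly_Mapping.lookup (lin_ext \<phi> p) c =
    (\<Sum>b\<in>A. Poly_Mapping.lookup p b * Poly_Mapping.lookup (\<phi> b) c)"
proof -
  have "Poly_Mapping.lookup (lin_ext \<phi> p) c =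
    (\<Sum>b\<in>Poly_Mapping.keys p. Poly_Mapping.lookup p b * Poly_Mapping.lookup (\<phi> b) c)"
    by (simp add: lin_ext_def lookup_sum)
  also have "\<dots> = (\<Sum>b\<in>A. Poly_Mapping.lookup p b * Poly_Mapping.lookup (\<phi> b) c)"
    using assms by (intro sum.mono_neutral_left) (auto simp: in_keys_iff)
  finally show ?thesis .
qed

lemma lin_ext_basis [simp]: "lin_ext \<phi> (basis b) = \<phi> b"
  by (rule poly_mapping_eqI) (simp add: lookup_lin_ext[where A = "{b}"] lookup_basis)

lemma lin_ext_add: "lin_ext \<phi> (p + q) = lin_ext \<phi> p + lin_ext \<phi> q"
proof (rule poly_mapping_eqI)
  fix c
  let ?A = "Poly_Mapping.keys p \<union> Poly_Mapping.keys q"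
  have "Poly_Mapping.keys (p + q) \<subseteq> ?A" by (rule keys_add)
  then show "Poly_Mapping.lookup (lin_ext \<phi> (p + q)) c
      = Poly_Mapping.lookup (lin_ext \<phi> p + lin_ext \<phi> q) c"
    by (simp add: lookup_lin_ext[where A = ?A] lookup_add algebra_simps sum.distrib)
qed

lemma lin_ext_fscale: "lin_ext \<phi> (fscale k p) = fscale k (lin_ext \<phi> p)"
proof (rule poly_mapping_eqI)
  fix c
  have "Poly_Mapping.keys (fscale k p) \<subseteq> Poly_Mapping.keys p"
    by (auto simp: in_keys_iff)
  then show "Poly_Mapping.lookup (lin_ext \<phi> (fscale k p)) c
      = Poly_Mapping.lookup (fscale k (lin_ext \<phi> p)) c"
    by (simp add: lookup_lin_ext[where A = "Poly_Mapping.keys p"] algebra_simps sum_distrib_left)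
qed

lemma linear_fscaleI:
  assumes "\<And>p q. F (p + q) = F p + F q" "\<And>k p. F (fscale k p) = fscale k (F p)"
  shows "Vector_Spaces.linear fscale fscale F"
  using assms by (simp add: Vector_Spaces.linear_iff vector_space_fscale)

lemma linear_lin_ext: "Vector_Spaces.linear fscale fscale (lin_ext \<phi>)"
  by (intro linear_fscaleI lin_ext_add lin_ext_fscale)

lemma linear_lin_ext_eq:
  fixes F :: "('b \<Rightarrow>\<^sub>0 'k::field) \<Rightarrow> ('c \<Rightarrow>\<^sub>0 'k)"
  assumes "Vector_Spaces.linear fscale fscale F"
  shows "F = lin_ext (\<lambda>b. F (basis b))"
proof
  fix p :: "'b \<Rightarrow>\<^sub>0 'k"
  interpret F: Vector_Spaces.linear fscale fscale F by fact
  have "p = (\<Sum>b\<in>Poly_Mapping.keys p. fscale (Poly_Mapping.lookup p b) (basis b))"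
    by (rule poly_mapping_eqI)
      (simp add: lookup_sum lookup_basis if_distrib not_in_keys_iff_lookup_eq_zero cong: if_cong)
  then have "F p = F (\<Sum>b\<in>Poly_Mapping.keys p. fscale (Poly_Mapping.lookup p b) (basis b))"
    by simp
  then show "F p = lin_ext (\<lambda>b. F (basis b)) p"
    by (simp add: F.sum F.scale lin_ext_def)
qed

lemma linear_eqI:
  assumes "Vector_Spaces.linear fscale fscale F" "Vector_Spaces.linear fscale fscale G"
    and "\<And>b. F (basis b) = G (basis b)"
  shows "F = G"
  using linear_lin_ext_eq[OF assms(1)] linear_lin_ext_eq[OF assms(2)] assms(3) by simp

lemma lookup_linear:
  assumes "Vector_Spaces.linear fscale fscale F" "finite A" "Poly_Mapping.keys p \<subseteq> A"
  shows "Poly_Mapping.lookup (F p) c =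
    (\<Sum>b\<in>A. Poly_Mapping.lookup p b * Poly_Mapping.lookup (F (basis b)) c)"
  by (subst linear_lin_ext_eq[OF assms(1)]) (rule lookup_lin_ext[OF assms(2,3)])

lemma linear_comp:
  assumes "Vector_Spaces.linear fscale fscale F" "Vector_Spaces.linear fscale fscale G"
  shows "Vector_Spaces.linear fscale fscale (G \<circ> F)"
  using assms by (rule Vector_Spaces.linear_compose)

section \<open>Coefficients of tensor products and of \<open>r12\<close> and
  \<open>r23\<close>\<close>

lemma lookup_tensor:
  "Poly_Mapping.lookup (tensor p q) (b, c) = Poly_Mapping.lookup p b * Poly_Mapping.lookup q c"
proof -
  have inner: "Poly_Mapping.lookup (lin_ext (\<lambda>c. basis (b', c)) q) (b, c) =
      (if b' = b then Poly_Mapping.lookup q c else 0)" for b'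
    by (simp add: lookup_lin_ext[OF finite_keys order_refl] lookup_basis if_distrib
      not_in_keys_iff_lookup_eq_zero cong: if_cong)
  show ?thesis
    unfolding tensor_def lookup_lin_ext[OF finite_keys[of p] order_refl] inner
    by (simp add: if_distrib not_in_keys_iff_lookup_eq_zero cong: if_cong)
qed

lemma tensor_map_basis: "tensor_map f g (basis (b, c)) = tensor (f (basis b)) (g (basis c))"
  by (simp add: tensor_map_def)

lemma linear_tensor_map: "Vector_Spaces.linear fscale fscale (tensor_map f g)"
  unfolding tensor_map_def by (rule linear_lin_ext)

lemma lookup_assoc_r: "Poly_Mapping.lookup (assoc_r p) (b, c, d) = Poly_Mapping.lookup p ((b, c), d)"
proof -
  have "Poly_Mapping.lookup (assoc_r p) (b, c, d) = (\<Sum>z\<in>Poly_Mapping.keys p.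
      if z = ((b, c), d) then Poly_Mapping.lookup p z else 0)"
    unfolding assoc_r_def lookup_lin_ext[OF finite_keys order_refl]
    by (intro sum.cong) (auto simp: lookup_basis split: if_splits)
  then show ?thesis
    by (simp add: not_in_keys_iff_lookup_eq_zero)
qed

lemma lookup_r12:
  "Poly_Mapping.lookup (r12 r (basis (i, j, k))) (i', j', k') =
    (if k = k' then Poly_Mapping.lookup (r (basis (i, j))) (i', j') else 0)"
  by (simp add: r12_def assoc_l_def tensor_map_basis lookup_assoc_r lookup_tensor lookup_basis)

lemma lookup_r23:
  "Poly_Mapping.lookup (r23 r (basis (i, j, k))) (i', j', k') =
    (if i = i' then Poly_Mapping.lookup (r (basis (j, k))) (j', k') else 0)"
  by (simp add: r23_def tensor_map_basis lookup_tensor lookup_basis)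

lemma linear_r12: "Vector_Spaces.linear fscale fscale (r12 r)"
  unfolding r12_def assoc_l_def assoc_r_def
  by (intro linear_comp linear_lin_ext linear_tensor_map)

lemma linear_r23: "Vector_Spaces.linear fscale fscale (r23 r)"
  unfolding r23_def by (rule linear_tensor_map)

section \<open>Incidence matrices\<close>

text \<open>\<open>n a b c d\<close> is the coefficient of the interval \<open>(c, d)\<close> in the image of \<open>(a, b)\<close>, after the order
  automorphism of the group-like elements has been undone. \<open>split\<close> says that the map respects the
  comultiplication.\<close>

locale incidence_matrix =
  fixes n :: "'p::order \<Rightarrow> 'p \<Rightarrow> 'p \<Rightarrow> 'p \<Rightarrow> 'k::field"
  assumes finite_interval: "\<And>a b :: 'p. finite {a..b}"
    and support: "\<And>a b c d. n a b c d \<noteq> 0 \<Longrightarrow> a \<le> c \<and> c \<le> d \<and> d \<le> b"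
    and split: "\<And>a b c d g. a \<le> c \<Longrightarrow> c \<le> g \<Longrightarrow> g \<le> d \<Longrightarrow> d \<le> b \<Longrightarrow>
      n a b c d = n a g c g * n g b g d"
    and counit: "\<And>a b. a \<le> b \<Longrightarrow> (\<Sum>c\<in>{a..b}. n a b c c) = (if a = b then 1 else 0)"
begin

lemma diag: "n a a a a = 1"
  using counit[of a a] by simp

text \<open>Split first at \<open>c\<close> and then, inside \<open>[c, b]\<close>, at
  \<open>d\<close>. The resulting upper, full and lower extremal coefficients can be compared
  separately.\<close>

lemma factor:
  assumes "a \<le> c" "c \<le> d" "d \<le> b"
  shows "n a b c d = n a c c c * n c d c d * n d b d d"
proof -
  have "n a b c d = n a c c c * n c b c d" using assms by (intro split) auto
  also have "n c b c d = n c d c d * n d b d d" using assms by (intro split) auto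
  finally show ?thesis by (simp add: mult_ac)
qed

text \<open>Solve the vanishing counit sum for its term at \<open>b\<close> and split each remaining
  term at its point \<open>c\<close>. The right side contains upper coefficients of shorter
  intervals and lower extremal ones only, so it works as a recursion.\<close>

lemma upper:
  assumes "a < b"
  shows "n a b b b = - (\<Sum>c\<in>{a..<b}. n a c c c * n c b c c)"
proof -
  have "{a..b} = insert b {a..<b}" using assms by auto
  then have "n a b b b + (\<Sum>c\<in>{a..<b}. n a b c c) = 0"
    using counit[of a b] assms finite_subset[OF _ finite_interval[of a b], of "{a..<b}"]
    by (simp add: subset_eq)
  moreover have "(\<Sum>c\<in>{a..<b}. n a b c c) = (\<Sum>c\<in>{a..<b}. n a c c c * n c b c c)"
    by (rule sum.cong) (auto intro!: split)
  ultimately show ?thesis by (simp add: eq_neg_iff_add_eq_0)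
qed

end

section \<open>Rigidity: the coefficients that determine an incidence matrix\<close>

lemma interval_induct [consumes 2, case_names interval]:
  fixes a b :: "'p::order"
  assumes fin: "\<And>a b :: 'p. finite {a..b}" and "a \<le> b"
    and step: "\<And>a b. a \<le> b \<Longrightarrow>
      (\<And>c d. a \<le> c \<Longrightarrow> c \<le> d \<Longrightarrow> d \<le> b \<Longrightarrow> (c, d) \<noteq> (a, b) \<Longrightarrow> P c d) \<Longrightarrow> P a b"
  shows "P a b"
  using \<open>a \<le> b\<close>
proof (induction "card {a..b}" arbitrary: a b rule: less_induct)
  case less
  show ?case
  proof (rule step[OF less.prems])
    fix c d assume cd: "a \<le> c" "c \<le> d" "d \<le> b" "(c, d) \<noteq> (a, b)"
    then have "a \<notin> {c..d} \<or> b \<notin> {c..d}" by auto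
    then have "{c..d} \<subset> {a..b}" using cd less.prems by auto
    then show "P c d" using less.hyps fin cd(2) by (simp add: psubset_card_mono)
  qed
qed

text \<open>\<open>factor\<close> reduces the claim to its three kinds of factors. The premises
  \<open>lower\<close> and \<open>cover\<close> correspond to the two families of inclusions tested
  in the theorem.\<close>

lemma (in incidence_matrix) rigid:
  assumes "incidence_matrix m"
    and lower: "\<And>a b. a < b \<Longrightarrow> n a b a a = m a b a a"
    and cover: "\<And>a b. a < b \<Longrightarrow> (\<And>c. \<not> (a < c \<and> c < b)) \<Longrightarrow> n a b a b = m a b a b"
  shows "n = m"
proof -
  interpret m: incidence_matrix m by fact
  have lower': "n a b a a = m a b a a" if "a \<le> b" for a b
    using that lower[of a b] by (cases "a = b") (auto simp: diag m.diag)
  \<comment> \<open>An interior point splits a full coefficient into those of two shorter intervals;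
    the induction ends at points and covering pairs.\<close>
  have full: "n a b a b = m a b a b" if "a \<le> b" for a b
    using finite_interval that
  proof (induction rule: interval_induct)
    case (interval a b)
    consider "a = b" | "a < b" "\<And>c. \<not> (a < c \<and> c < b)" | c where "a < c" "c < b"
      using interval.hyps by force
    then show ?case
    proof cases
      case 3
      then have "n a b a b = n a c a c * n c b c b" "m a b a b = m a c a c * m c b c b"
        by (auto intro!: split m.split)
      then show ?thesis using interval.IH[of a c] interval.IH[of c b] 3 by auto
    qed (auto simp: diag m.diag cover)
  qed
  \<comment> \<open>In the recursion \<open>upper\<close>, the first factors are covered by the
    induction hypothesis and the second ones by \<open>lower'\<close>.\<close>
  have up: "n a b b b = m a b b b" if "a \<le> b" for a b
    using finite_interval that
  proof (induction rule: interval_induct)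
    case (interval a b)
    show ?case
    proof (cases "a = b")
      case False
      then have "a < b" using interval.hyps by simp
      then show ?thesis
        unfolding upper[OF \<open>a < b\<close>] m.upper[OF \<open>a < b\<close>]
        by (auto simp: lower' interval.IH intro!: sum.cong)
    qed (simp add: diag m.diag)
  qed
  show ?thesis
  proof (intro ext)
    fix a b c d
    show "n a b c d = m a b c d"
    proof (cases "a \<le> c \<and> c \<le> d \<and> d \<le> b")
      case True
      then show ?thesis
        using factor[of a c d b] m.factor[of a c d b] by (simp add: full up lower')
    next
      case False
      then have "n a b c d = 0" "m a b c d = 0"
        using support[of a b c d] m.support[of a b c d] by blast+
      then show ?thesis by simp
    qed
  qed
qed

section \<open>Composition of incidence matrices\<close>

text \<open>The matrix of a composite, \<open>n\<close> first, when neither map moves points: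
  \<open>[x, y]\<close> runs over the intermediate intervals that \<open>support\<close>
  allows.\<close>

definition star ::
    "('p::order \<Rightarrow> 'p \<Rightarrow> 'p \<Rightarrow> 'p \<Rightarrow> 'k::field) \<Rightarrow> ('p \<Rightarrow> 'p \<Rightarrow> 'p \<Rightarrow> 'p \<Rightarrow> 'k) \<Rightarrow>
     'p \<Rightarrow> 'p \<Rightarrow> 'p \<Rightarrow> 'p \<Rightarrow> 'k" where
  "star n m a b c d = (\<Sum>x\<in>{a..c}. \<Sum>y\<in>{d..b}. n a b x y * m x y c d)"

lemma incidence_matrix_star:
  assumes "incidence_matrix n" "incidence_matrix m"
  shows "incidence_matrix (star n m)"
proof -
  interpret n: incidence_matrix n by fact
  interpret m: incidence_matrix m by fact
  note fin = n.finite_interval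
  show ?thesis
  proof
    fix a b :: 'a
    show "finite {a..b}" by (rule fin)
  next
    fix a b c d
    assume "star n m a b c d \<noteq> 0"
    then obtain x y where "x \<in> {a..c}" "y \<in> {d..b}" "n a b x y * m x y c d \<noteq> 0"
      unfolding star_def by (metis (no_types, lifting) sum.not_neutral_contains_not_neutral)
    then show "a \<le> c \<and> c \<le> d \<and> d \<le> b"
      using n.support[of a b x y] m.support[of x y c d] by auto
  next
    fix a b c d g :: 'a
    assume *: "a \<le> c" "c \<le> g" "g \<le> d" "d \<le> b"
    \<comment> \<open>Both matrices split at \<open>g\<close>, which leaves one factor depending on
      \<open>x\<close> only and one on \<open>y\<close> only; the double sum becomes a
      product.\<close>
    have "star n m a b c d =
        (\<Sum>x\<in>{a..c}. \<Sum>y\<in>{d..b}. (n a g x g * m x g c g) * (n g b g y * m g y g d))"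
      unfolding star_def
    proof (intro sum.cong refl)
      fix x y assume "x \<in> {a..c}" "y \<in> {d..b}"
      then have "n a b x y = n a g x g * n g b g y" "m x y c d = m x g c g * m g y g d"
        using * by (auto intro!: n.split m.split)
      then show "n a b x y * m x y c d = (n a g x g * m x g c g) * (n g b g y * m g y g d)"
        by simp
    qed
    also have "\<dots> = star n m a g c g * star n m g b g d"
      by (simp add: star_def sum_product)
    finally show "star n m a b c d = star n m a g c g * star n m g b g d" .
  next
    fix a b :: 'a assume ab: "a \<le> b"
    \<comment> \<open>The inner ranges are enlarged to \<open>{a..b}\<close>, where the added terms
      vanish by \<open>support\<close>, so that the sum over \<open>c\<close> can be carried out
      first.\<close>
    have "(\<Sum>c\<in>{a..b}. star n m a b c c) =
        (\<Sum>c\<in>{a..b}. \<Sum>x\<in>{a..b}. \<Sum>y\<in>{a..b}. n a b x y * m x y c c)"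
      unfolding star_def
    proof (rule sum.cong[OF refl])
      fix c assume c: "c \<in> {a..b}"
      have "(\<Sum>x\<in>{a..c}. \<Sum>y\<in>{c..b}. n a b x y * m x y c c) =
          (\<Sum>x\<in>{a..c}. \<Sum>y\<in>{a..b}. n a b x y * m x y c c)"
        using c fin m.support[of _ _ c c] by (intro sum.cong refl sum.mono_neutral_left) auto
      also have "\<dots> = (\<Sum>x\<in>{a..b}. \<Sum>y\<in>{a..b}. n a b x y * m x y c c)"
        using c fin m.support[of _ _ c c] by (intro sum.mono_neutral_left) (auto intro!: sum.neutral)
      finally show "(\<Sum>x\<in>{a..c}. \<Sum>y\<in>{c..b}. n a b x y * m x y c c) =
          (\<Sum>x\<in>{a..b}. \<Sum>y\<in>{a..b}. n a b x y * m x y c c)" .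
    qed
    also have "\<dots> = (\<Sum>x\<in>{a..b}. \<Sum>c\<in>{a..b}. \<Sum>y\<in>{a..b}. n a b x y * m x y c c)"
      by (rule sum.swap)
    also have "\<dots> = (\<Sum>x\<in>{a..b}. \<Sum>y\<in>{a..b}. \<Sum>c\<in>{a..b}. n a b x y * m x y c c)"
      by (intro sum.cong refl sum.swap)
    also have "\<dots> = (\<Sum>x\<in>{a..b}. \<Sum>y\<in>{a..b}. if y = x then n a b x x else 0)"
    proof (intro sum.cong refl)
      fix x y assume xy: "x \<in> {a..b}" "y \<in> {a..b}"
      have "(\<Sum>c\<in>{a..b}. m x y c c) = (\<Sum>c\<in>{x..y}. m x y c c)"
        using xy fin m.support[of x y] by (intro sum.mono_neutral_right) (auto, metis+)
      then have "(\<Sum>c\<in>{a..b}. n a b x y * m x y c c) = n a b x y * (\<Sum>c\<in>{x..y}. m x y c c)"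
        by (simp flip: sum_distrib_left)
      \<comment> \<open>For \<open>x \<le> y\<close> this is the counit of \<open>m\<close>;
        otherwise \<open>n a b x y\<close> is 0 by \<open>support\<close>.\<close>
      also have "\<dots> = (if y = x then n a b x x else 0)"
        using n.support[of a b x y] m.counit[of x y] by (cases "x \<le> y") auto
      finally show "(\<Sum>c\<in>{a..b}. n a b x y * m x y c c) = (if y = x then n a b x x else 0)" .
    qed
    also have "\<dots> = (if a = b then 1 else 0)"
      using ab fin by (simp add: n.counit)
    finally show "(\<Sum>c\<in>{a..b}. star n m a b c c) = (if a = b then 1 else 0)" .
  qed
qed

section \<open>Transport along order automorphisms\<close>

definition order_auto :: "('p::order \<Rightarrow> 'p) \<Rightarrow> bool" where
  "order_auto \<phi> \<longleftrightarrow> bij \<phi> \<and> (\<forall>a b. \<phi> a \<le> \<phi> b \<longleftrightarrow> a \<le> b)"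

text \<open>In a composite the first map has already moved the points by \<open>\<phi>\<close>, so
  the coefficients of the second map are read at the images of the points.\<close>

definition pullback ::
    "('p \<Rightarrow> 'q) \<Rightarrow> ('q \<Rightarrow> 'q \<Rightarrow> 'q \<Rightarrow> 'q \<Rightarrow> 'k) \<Rightarrow> 'p \<Rightarrow> 'p \<Rightarrow> 'p \<Rightarrow> 'p \<Rightarrow> 'k" where
  "pullback \<phi> n a b c d = n (\<phi> a) (\<phi> b) (\<phi> c) (\<phi> d)"

lemma order_auto_image:
  assumes "order_auto \<phi>"
  shows "\<phi> ` {a..b} = {\<phi> a..\<phi> b}"
proof
  show "{\<phi> a..\<phi> b} \<subseteq> \<phi> ` {a..b}"
  proof
    fix y assume y: "y \<in> {\<phi> a..\<phi> b}"
    obtain x where "y = \<phi> x" using assms by (metis order_auto_def bij_pointE)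
    then show "y \<in> \<phi> ` {a..b}" using y assms by (auto simp: order_auto_def)
  qed
qed (use assms in \<open>auto simp: order_auto_def\<close>)

lemma order_auto_le_iff: "order_auto \<phi> \<Longrightarrow> \<phi> a \<le> \<phi> b \<longleftrightarrow> a \<le> b"
  unfolding order_auto_def by blast

lemma order_auto_inj: "order_auto \<phi> \<Longrightarrow> inj_on \<phi> A"
  using inj_on_subset by (auto simp: order_auto_def bij_def)

lemma incidence_matrix_pullback:
  assumes "order_auto \<phi>" "incidence_matrix n"
  shows "incidence_matrix (pullback \<phi> n)"
proof -
  interpret incidence_matrix n by fact
  have mono: "\<phi> a \<le> \<phi> b \<longleftrightarrow> a \<le> b" for a b using assms by (simp add: order_auto_def)
  show ?thesis
  proof
    fix a b :: 'a
    show "finite {a..b}"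
      using finite_interval[of "\<phi> a" "\<phi> b"] order_auto_image[OF assms(1)] order_auto_inj[OF assms(1)]
      by (metis finite_imageD)
    assume "a \<le> b"
    have "(\<Sum>c\<in>{a..b}. pullback \<phi> n a b c c) = (\<Sum>c\<in>{\<phi> a..\<phi> b}. n (\<phi> a) (\<phi> b) c c)"
      by (simp add: pullback_def sum.reindex order_auto_inj[OF assms(1)]
        flip: order_auto_image[OF assms(1)])
    then show "(\<Sum>c\<in>{a..b}. pullback \<phi> n a b c c) = (if a = b then 1 else 0)"
      using counit[of "\<phi> a" "\<phi> b"] \<open>a \<le> b\<close> mono order_auto_inj[OF assms(1), of UNIV]
      by (simp add: inj_eq)
  next
    fix a b c d g :: 'a
    assume "a \<le> c" "c \<le> g" "g \<le> d" "d \<le> b"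
    then show "pullback \<phi> n a b c d = pullback \<phi> n a g c g * pullback \<phi> n g b g d"
      by (auto simp: pullback_def mono intro!: split)
  next
    fix a b c d
    assume "pullback \<phi> n a b c d \<noteq> 0"
    then show "a \<le> c \<and> c \<le> d \<and> d \<le> b"
      using support[of "\<phi> a" "\<phi> b" "\<phi> c" "\<phi> d"] by (simp add: pullback_def mono)
  qed
qed

section \<open>Automorphisms of incidence coalgebras\<close>

text \<open>\<open>E a b\<close> is the basis element of the incidence coalgebra of \<open>'p\<close> given by the interval \<open>[a, b]\<close>.\<close>

locale interval_basis =
  fixes E :: "'p::order \<Rightarrow> 'p \<Rightarrow> 'b"
  assumes finite_interval: "\<And>a b :: 'p. finite {a..b}"
    and E_inject: "\<And>a b c d. a \<le> b \<Longrightarrow> c \<le> d \<Longrightarrow> E a b = E c d \<longleftrightarrow> a = c \<and> b = d"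
    and E_surj: "\<And>u. \<exists>a b. a \<le> b \<and> u = E a b"
begin

text \<open>Target intervals are indexed by their preimages under \<open>\<phi>\<close>, which makes
  the coefficients those of an incidence matrix. The basis \<open>E\<close> is abstract because the
  notion is applied both to \<open>ival2\<close> and to \<open>ival3\<close>.\<close>

definition represents ::
    "(('b \<Rightarrow>\<^sub>0 'k::field) \<Rightarrow> ('b \<Rightarrow>\<^sub>0 'k)) \<Rightarrow> ('p \<Rightarrow> 'p) \<Rightarrow> ('p \<Rightarrow> 'p \<Rightarrow> 'p \<Rightarrow> 'p \<Rightarrow> 'k) \<Rightarrow> bool" where
  "represents F \<phi> n \<longleftrightarrow>
     Vector_Spaces.linear fscale fscale F \<and> order_auto \<phi> \<and> incidence_matrix n \<and>
     (\<forall>a b c d. a \<le> b \<longrightarrow> c \<le> d \<longrightarrow>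
       Poly_Mapping.lookup (F (basis (E a b))) (E (\<phi> c) (\<phi> d)) = n a b c d)"

lemma E_surj_order_auto:
  assumes "order_auto \<phi>"
  obtains a b where "a \<le> b" "u = E (\<phi> a) (\<phi> b)"
proof -
  obtain a' b' where "a' \<le> b'" "u = E a' b'" using E_surj by blast
  moreover obtain a b where "a' = \<phi> a" "b' = \<phi> b"
    using assms by (metis order_auto_def bij_pointE)
  ultimately show thesis using that assms by (auto simp: order_auto_def)
qed

text \<open>Matrix multiplication, the intermediate basis elements being written as
  \<open>E (\<phi> x) (\<phi> y)\<close>; hence the pullback of \<open>m\<close> along
  \<open>\<phi>\<close>.\<close>

lemma represents_comp:
  assumes F: "represents F \<phi> n" and G: "represents G \<psi> m"
  shows "represents (G \<circ> F) (\<psi> \<circ> \<phi>) (star n (pullback \<phi> m))"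
proof -
  interpret n: incidence_matrix n using F by (simp add: represents_def)
  interpret m: incidence_matrix m using G by (simp add: represents_def)
  have auto: "order_auto \<phi>" "order_auto \<psi>" using F G by (auto simp: represents_def)
  have mono: "\<phi> a \<le> \<phi> b \<longleftrightarrow> a \<le> b" "\<psi> (\<phi> a) \<le> \<psi> (\<phi> b) \<longleftrightarrow> a \<le> b"
    and inj: "\<phi> a = \<phi> b \<longleftrightarrow> a = b" for a b
    using auto by (auto simp: order_auto_def bij_def inj_eq)
  have lF: "Poly_Mapping.lookup (F (basis (E a b))) (E (\<phi> c) (\<phi> d)) = n a b c d"
    if "a \<le> b" "c \<le> d" for a b c d
    using that F by (simp add: represents_def)
  have lG: "Poly_Mapping.lookup (G (basis (E a b))) (E (\<psi> c) (\<psi> d)) = m a b c d"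
    if "a \<le> b" "c \<le> d" for a b c d
    using that G by (simp add: represents_def)
  have "Poly_Mapping.lookup (G (F (basis (E a b)))) (E (\<psi> (\<phi> c)) (\<psi> (\<phi> d))) =
      star n (pullback \<phi> m) a b c d" if "a \<le> b" "c \<le> d" for a b c d
  proof -
    \<comment> \<open>The \<open>support\<close> of \<open>n\<close> confines the keys of the image
      to the subintervals of \<open>[a, b]\<close>, finitely many by local finiteness.\<close>
    define S where "S = {(x, y). a \<le> x \<and> x \<le> y \<and> y \<le> b}"
    have fin: "finite S"
      by (rule finite_subset[of _ "{a..b} \<times> {a..b}"]) (auto simp: S_def finite_interval)
    define e where "e = (\<lambda>(x, y). E (\<phi> x) (\<phi> y))"
    have inj_e: "inj_on e S" by (auto simp: inj_on_def S_def e_def E_inject mono inj)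
    have keys: "Poly_Mapping.keys (F (basis (E a b))) \<subseteq> e ` S"
    proof
      fix u assume u: "u \<in> Poly_Mapping.keys (F (basis (E a b)))"
      obtain x y where xy: "x \<le> y" "u = E (\<phi> x) (\<phi> y)" using E_surj_order_auto[OF auto(1)] .
      then have "n a b x y \<noteq> 0" using u that lF[of a b x y] by (simp add: in_keys_iff)
      then show "u \<in> e ` S" using n.support[of a b x y] xy by (auto simp: e_def S_def)
    qed
    have "Poly_Mapping.lookup (G (F (basis (E a b)))) (E (\<psi> (\<phi> c)) (\<psi> (\<phi> d))) =
        (\<Sum>u\<in>e ` S. Poly_Mapping.lookup (F (basis (E a b))) u *
          Poly_Mapping.lookup (G (basis u)) (E (\<psi> (\<phi> c)) (\<psi> (\<phi> d))))"
      using G fin keys by (intro lookup_linear) (auto simp: represents_def)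
    also have "\<dots> = (\<Sum>(x, y)\<in>S. n a b x y * pullback \<phi> m x y c d)"
      unfolding sum.reindex[OF inj_e] using that
      by (intro sum.cong) (auto simp: S_def e_def lF lG mono pullback_def)
    also have "\<dots> = (\<Sum>(x, y)\<in>{a..c} \<times> {d..b}. n a b x y * pullback \<phi> m x y c d)"
    proof (rule sum.mono_neutral_right[OF fin])
      show "{a..c} \<times> {d..b} \<subseteq> S" using that by (auto simp: S_def)
      show "\<forall>z\<in>S - {a..c} \<times> {d..b}. (case z of (x, y) \<Rightarrow> n a b x y * pullback \<phi> m x y c d) = 0"
      proof
        fix z assume z: "z \<in> S - {a..c} \<times> {d..b}"
        obtain x y where xy: "z = (x, y)" by fastforce
        then have "\<not> (x \<le> c \<and> d \<le> y)" using z by (auto simp: S_def)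
        then have "pullback \<phi> m x y c d = 0"
          using m.support[of "\<phi> x" "\<phi> y" "\<phi> c" "\<phi> d"] by (auto simp: pullback_def mono)
        then show "(case z of (x, y) \<Rightarrow> n a b x y * pullback \<phi> m x y c d) = 0"
          by (simp add: xy)
      qed
    qed
    finally show ?thesis by (simp add: star_def sum.cartesian_product)
  qed
  moreover have "order_auto (\<psi> \<circ> \<phi>)" using auto by (auto simp: order_auto_def bij_comp)
  moreover have "incidence_matrix (star n (pullback \<phi> m))"
    using auto n.incidence_matrix_axioms m.incidence_matrix_axioms
    by (intro incidence_matrix_star incidence_matrix_pullback)
  ultimately show ?thesis using F G by (simp add: represents_def linear_comp)
qed

text \<open>A linear map is determined by its coefficients on the basis, and at indices that are not
  nested intervals both matrices vanish by \<open>support\<close>.\<close>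

lemma represents_eq_iff:
  assumes F: "represents F \<phi> n" and G: "represents G \<phi> m"
  shows "F = G \<longleftrightarrow> n = m"
proof
  interpret n: incidence_matrix n using F by (simp add: represents_def)
  interpret m: incidence_matrix m using G by (simp add: represents_def)
  assume FG: "F = G"
  show "n = m"
  proof (intro ext)
    fix a b c d
    show "n a b c d = m a b c d"
    proof (cases "a \<le> c \<and> c \<le> d \<and> d \<le> b")
      case True
      then have "a \<le> b" "c \<le> d" by auto
      then show ?thesis using F G FG by (metis represents_def)
    next
      case False
      then have "n a b c d = 0" "m a b c d = 0"
        using n.support[of a b c d] m.support[of a b c d] by blast+
      then show ?thesis by simp
    qed
  qed
next
  assume nm: "n = m"
  show "F = G"
  proof (rule linear_eqI)
    fix u
    obtain a b where ab: "a \<le> b" "u = E a b" using E_surj by blast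
    show "F (basis u) = G (basis u)"
    proof (rule poly_mapping_eqI)
      fix v
      obtain c d where "c \<le> d" "v = E (\<phi> c) (\<phi> d)"
        using E_surj_order_auto[of \<phi> v] F by (auto simp: represents_def)
      then show "Poly_Mapping.lookup (F (basis u)) v = Poly_Mapping.lookup (G (basis u)) v"
        using F G nm ab by (simp add: represents_def)
    qed
  qed (use F G in \<open>auto simp: represents_def\<close>)
qed

end

section \<open>Group-like elements and the induced order automorphism\<close>

text \<open>The equation \<open>comult\<close> compares the coefficients of \<open>E e g\<close>
  tensor \<open>E g' f\<close> on both sides of compatibility with the comultiplication; the
  comultiplication of an image contributes only if the inner ends \<open>g\<close> and
  \<open>g'\<close> agree. \<open>counit\<close> sums over the finitely many nonzero diagonal
  coefficients.\<close>

locale incidence_automorphism = interval_basis E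
  for E :: "'p::order \<Rightarrow> 'p \<Rightarrow> 'b" +
  fixes F :: "('b \<Rightarrow>\<^sub>0 'k::field) \<Rightarrow> ('b \<Rightarrow>\<^sub>0 'k)"
    and M :: "'p \<Rightarrow> 'p \<Rightarrow> 'p \<Rightarrow> 'p \<Rightarrow> 'k"
  defines "M \<equiv> \<lambda>a b e f. Poly_Mapping.lookup (F (basis (E a b))) (E e f)"
  assumes linear: "Vector_Spaces.linear fscale fscale F"
    and bij: "bij F"
    and comult: "\<And>a b e f g g'. a \<le> b \<Longrightarrow> e \<le> g \<Longrightarrow> g' \<le> f \<Longrightarrow>
      (\<Sum>c\<in>{a..b}. M a c e g * M c b g' f) = (if g = g' then M a b e f else 0)"
    and counit: "\<And>a b. a \<le> b \<Longrightarrow> (\<Sum>e | M a b e e \<noteq> 0. M a b e e) = (if a = b then 1 else 0)"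
begin

text \<open>On a point, \<open>comult\<close> makes the diagonal coefficients orthogonal idempotents
  of the field, so by \<open>counit\<close> exactly one of them is 1. Every coefficient is a
  multiple of the diagonal ones at both of its ends, which leaves only that point.\<close>

lemma group_like: "\<exists>e. F (basis (E a a)) = basis (E e e)"
proof -
  have prod: "M a a e g * M a a g' f = (if g = g' then M a a e f else 0)" if "e \<le> g" "g' \<le> f"
    for e g g' f
    using comult[of a a e g g' f] that by simp
  have "(\<Sum>e | M a a e e \<noteq> 0. M a a e e) \<noteq> 0" using counit[of a a] by simp
  then obtain e where e: "M a a e e \<noteq> 0" by (metis (mono_tags, lifting) sum.neutral)
  have one: "M a a e e = 1" using prod[of e e e e] e by simp
  have "F (basis (E a a)) = basis (E e e)"
  proof (rule poly_mapping_eqI)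
    fix u
    obtain x y where xy: "x \<le> y" "u = E x y" using E_surj by blast
    have zero: "M a a z z = 0" if "z \<noteq> e" for z
      using prod[of e e z z] one that by simp
    have "M a a x y = (if x = e \<and> y = e then 1 else 0)"
      using prod[of x x x y] prod[of x y y y] zero[of x] zero[of y] one xy(1) by auto
    then show "Poly_Mapping.lookup (F (basis (E a a))) u = Poly_Mapping.lookup (basis (E e e)) u"
      using xy E_inject[of e e x y] by (auto simp: lookup_basis M_def)
  qed
  then show ?thesis ..
qed

definition \<phi> :: "'p \<Rightarrow> 'p" where
  "\<phi> a = (SOME e. F (basis (E a a)) = basis (E e e))"

lemma F_point: "F (basis (E a a)) = basis (E (\<phi> a) (\<phi> a))"
  unfolding \<phi>_def by (rule someI_ex) (rule group_like)

lemma M_point: "e \<le> f \<Longrightarrow> M a a e f = (if e = \<phi> a \<and> f = \<phi> a then 1 else 0)"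
  by (auto simp: M_def F_point lookup_basis E_inject)

lemma inj_\<phi>: "inj \<phi>"
proof
  fix a b assume "\<phi> a = \<phi> b"
  then have "F (basis (E a a)) = F (basis (E b b))" by (simp add: F_point)
  then have "basis (E a a) = (basis (E b b) :: _ \<Rightarrow>\<^sub>0 'k)" using bij by (simp add: bij_def inj_eq)
  then have "E a a = E b b" by (metis keys_basis singleton_inject)
  then show "a = b" by (simp add: E_inject)
qed

text \<open>Surjectivity of \<open>F\<close>: \<open>basis (E x y)\<close> is itself an image, so
  the coefficient of \<open>E x y\<close> cannot vanish in the images of all basis elements.\<close>

lemma M_nonzero:
  assumes "x \<le> y"
  obtains a b where "a \<le> b" "M a b x y \<noteq> 0"
proof -
  obtain p where p: "basis (E x y) = F p" using bij by (metis bij_pointE)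
  have "(\<Sum>u\<in>Poly_Mapping.keys p. Poly_Mapping.lookup p u *
      Poly_Mapping.lookup (F (basis u)) (E x y)) \<noteq> 0"
    using lookup_linear[OF linear finite_keys order_refl, of p "E x y"]
    by (simp add: lookup_basis flip: p)
  then obtain u where "Poly_Mapping.lookup (F (basis u)) (E x y) \<noteq> 0"
    by (metis (no_types, lifting) mult_zero_right sum.neutral)
  then show thesis using E_surj[of u] that by (auto simp: M_def)
qed

text \<open>Induction along \<open>comult\<close> with all four ends equal to \<open>e\<close>: a
  summand with \<open>c \<noteq> b\<close> contains the coefficient of the shorter interval
  \<open>[a, c]\<close>, and the one with \<open>c = b\<close> contains \<open>M b b e e\<close>,
  which is 0 because \<open>\<phi> b \<noteq> e\<close>.\<close>

lemma M_diag_vanishes: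
  assumes "a \<le> b" and "\<And>x. a \<le> x \<Longrightarrow> x \<le> b \<Longrightarrow> \<phi> x \<noteq> e"
  shows "M a b e e = 0"
  using finite_interval assms
proof (induction rule: interval_induct)
  case (interval a b)
  have "M a c e e * M c b e e = 0" if "c \<in> {a..b}" for c
  proof (cases "c = b")
    case True
    then show ?thesis using interval.prems[of b] interval.hyps M_point[of e e b] by auto
  next
    case False
    then have "M a c e e = 0"
      using that by (intro interval.IH interval.prems) (auto intro: order_trans)
    then show ?thesis by simp
  qed
  then have "(\<Sum>c\<in>{a..b}. M a c e e * M c b e e) = 0" by (intro sum.neutral ballI)
  then show ?case using comult[of a b e e e e] interval.hyps by simp
qed

text \<open>A point missed by \<open>\<phi>\<close> would have coefficient 0 in the image of every
  interval, against \<open>M_nonzero\<close>.\<close>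

lemma surj_\<phi>: "surj \<phi>"
proof (rule ccontr)
  assume "\<not> surj \<phi>"
  then obtain e where e: "\<And>x. \<phi> x \<noteq> e" unfolding surj_def by metis
  obtain a b where "a \<le> b" "M a b e e \<noteq> 0" using M_nonzero[of e e] by auto
  then show False using M_diag_vanishes[of a b e] e by auto
qed

lemma M_diag_support:
  assumes "a \<le> b" "M a b (\<phi> c) (\<phi> c) \<noteq> 0"
  shows "a \<le> c \<and> c \<le> b"
  using M_diag_vanishes[of a b "\<phi> c"] assms inj_\<phi> by (auto simp: inj_eq)

text \<open>Only the order of \<open>\<phi> c\<close> and \<open>\<phi> d\<close> is given, so the
  order of \<open>c\<close> and \<open>d\<close> has to be extracted from nonvanishing coefficients
  by cutting at \<open>\<phi> c\<close> and \<open>\<phi> d\<close>.\<close>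

lemma M_support:
  assumes "a \<le> b" "\<phi> c \<le> \<phi> d" "M a b (\<phi> c) (\<phi> d) \<noteq> 0"
  shows "a \<le> c \<and> c \<le> d \<and> d \<le> b"
proof -
  have lower: "\<exists>y. a \<le> y \<and> y \<le> b \<and> M a y (\<phi> c) (\<phi> c) \<noteq> 0 \<and> M y b (\<phi> c) (\<phi> d) \<noteq> 0"
    and upper: "\<exists>y. a \<le> y \<and> y \<le> b \<and> M a y (\<phi> c) (\<phi> d) \<noteq> 0 \<and> M y b (\<phi> d) (\<phi> d) \<noteq> 0"
    if ab: "a \<le> b" "M a b (\<phi> c) (\<phi> d) \<noteq> 0" for a b
  proof -
    have "(\<Sum>y\<in>{a..b}. M a y (\<phi> c) (\<phi> c) * M y b (\<phi> c) (\<phi> d)) \<noteq> 0"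
      using ab assms(2) comult[of a b "\<phi> c" "\<phi> c" "\<phi> c" "\<phi> d"] by simp
    then obtain y where "y \<in> {a..b}" "M a y (\<phi> c) (\<phi> c) * M y b (\<phi> c) (\<phi> d) \<noteq> 0"
      by (rule sum.not_neutral_contains_not_neutral)
    then show "\<exists>y. a \<le> y \<and> y \<le> b \<and> M a y (\<phi> c) (\<phi> c) \<noteq> 0 \<and> M y b (\<phi> c) (\<phi> d) \<noteq> 0"
      by auto
    have "(\<Sum>y\<in>{a..b}. M a y (\<phi> c) (\<phi> d) * M y b (\<phi> d) (\<phi> d)) \<noteq> 0"
      using ab assms(2) comult[of a b "\<phi> c" "\<phi> d" "\<phi> d" "\<phi> d"] by simp
    then obtain y where "y \<in> {a..b}" "M a y (\<phi> c) (\<phi> d) * M y b (\<phi> d) (\<phi> d) \<noteq> 0"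
      by (rule sum.not_neutral_contains_not_neutral)
    then show "\<exists>y. a \<le> y \<and> y \<le> b \<and> M a y (\<phi> c) (\<phi> d) \<noteq> 0 \<and> M y b (\<phi> d) (\<phi> d) \<noteq> 0"
      by auto
  qed
  have c: "a \<le> c \<and> c \<le> b" if ab: "a \<le> b" "M a b (\<phi> c) (\<phi> d) \<noteq> 0" for a b
  proof -
    obtain y where "a \<le> y" "y \<le> b" "M a y (\<phi> c) (\<phi> c) \<noteq> 0" using lower[OF ab] by blast
    then show ?thesis using M_diag_support[of a y c] by auto
  qed
  obtain y where y: "a \<le> y" "y \<le> b" "M a y (\<phi> c) (\<phi> c) \<noteq> 0" "M y b (\<phi> c) (\<phi> d) \<noteq> 0"
    using lower[OF assms(1,3)] by blast
  \<comment> \<open>The diagonal factor gives \<open>c \<le> y\<close>; the preceding fact, applied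
    to \<open>[y, b]\<close>, gives \<open>y \<le> c\<close>.\<close>
  have "y = c" using M_diag_support[OF y(1,3)] c[OF y(2,4)] by auto
  then have "M c b (\<phi> c) (\<phi> d) \<noteq> 0" "c \<le> b" using y by auto
  then obtain z where z: "c \<le> z" "z \<le> b" "M c z (\<phi> c) (\<phi> d) \<noteq> 0" "M z b (\<phi> d) (\<phi> d) \<noteq> 0"
    using upper[of c b] by blast
  \<comment> \<open>A second cut at \<open>\<phi> d\<close>, now of \<open>[c, z]\<close>: the
    diagonal factor on \<open>[w, z]\<close> gives \<open>d \<le> z\<close>, while the one on
    \<open>[z, b]\<close> gives \<open>z \<le> d\<close>.\<close>
  obtain w where w: "c \<le> w" "w \<le> z" "M c w (\<phi> c) (\<phi> d) \<noteq> 0" "M w z (\<phi> d) (\<phi> d) \<noteq> 0"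
    using upper[OF z(1,3)] by blast
  have "z \<le> d \<and> d \<le> b" "w \<le> d \<and> d \<le> z"
    using M_diag_support[OF z(2,4)] M_diag_support[OF w(2,4)] by simp_all
  then have "d = z" by (meson order.antisym)
  then show ?thesis using c[OF assms(1,3)] z by auto
qed

text \<open>The interval from \<open>\<phi> c\<close> to \<open>\<phi> d\<close> occurs in the image
  of some basis element, and then \<open>M_support\<close> orders \<open>c\<close> and
  \<open>d\<close>.\<close>

lemma \<phi>_reflects:
  assumes "\<phi> c \<le> \<phi> d"
  shows "c \<le> d"
proof -
  obtain a b where "a \<le> b" "M a b (\<phi> c) (\<phi> d) \<noteq> 0" using M_nonzero[OF assms] by auto
  then show ?thesis using M_support assms by blast
qed

text \<open>If \<open>\<phi>\<close> did not preserve a covering relation \<open>c < d\<close>, then \<open>F\<close> would map \<open>E c d\<close> into the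
  span of \<open>E (\<phi> c) (\<phi> c)\<close> and \<open>E (\<phi> d) (\<phi> d)\<close>, which is the image of that of \<open>E c c\<close> and \<open>E d d\<close>.\<close>

lemma \<phi>_mono:
  assumes "c \<le> d"
  shows "\<phi> c \<le> \<phi> d"
  using finite_interval assms
proof (induction rule: interval_induct)
  case (interval c d)
  consider "c = d" | "c < d" "\<And>x. \<not> (c < x \<and> x < d)" | x where "c < x" "x < d"
    using interval.hyps by force
  then show ?case
  proof cases
    case 2
    interpret F: Vector_Spaces.linear fscale fscale F by (rule linear)
    show ?thesis
    proof (rule ccontr)
      assume *: "\<not> \<phi> c \<le> \<phi> d"
      define p :: "'b \<Rightarrow>\<^sub>0 'k" where "p = fscale (M c d (\<phi> c) (\<phi> c)) (basis (E c c)) +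
        fscale (M c d (\<phi> d) (\<phi> d)) (basis (E d d))"
      have Fp: "F p = fscale (M c d (\<phi> c) (\<phi> c)) (basis (E (\<phi> c) (\<phi> c))) +
          fscale (M c d (\<phi> d) (\<phi> d)) (basis (E (\<phi> d) (\<phi> d)))"
        by (simp add: p_def F.add F.scale F_point)
      have "F (basis (E c d)) = F p"
      proof (rule poly_mapping_eqI)
        fix u
        obtain x' y' where xy': "x' \<le> y'" "u = E x' y'" using E_surj by blast
        then obtain x y where "x' = \<phi> x" "y' = \<phi> y" using surj_\<phi> by (metis surjD)
        then have xy: "\<phi> x \<le> \<phi> y" "u = E (\<phi> x) (\<phi> y)" using xy' by auto
        have "M c d (\<phi> x) (\<phi> y) = Poly_Mapping.lookup (F p) u"
        proof (cases "M c d (\<phi> x) (\<phi> y) = 0")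
          case True
          then show ?thesis using xy
            by (auto simp: Fp lookup_add lookup_basis E_inject)
        next
          case False
          then have "c \<le> x" "x \<le> y" "y \<le> d" using M_support[of c d x y] 2 xy by auto
          then have "x = c \<or> x = d" "y = c \<or> y = d" using 2(2) by (metis order.trans order_le_less)+
          \<comment> \<open>The mixed choices fail: \<open>x = c\<close>, \<open>y = d\<close> by
            \<open>*\<close>, and \<open>x = d\<close>, \<open>y = c\<close> by
            \<open>x \<le> y\<close>.\<close>
          then have "x = c \<and> y = c \<or> x = d \<and> y = d" using * xy 2 \<open>x \<le> y\<close> by auto
          then show ?thesis using 2 inj_\<phi>
            by (auto simp: xy Fp lookup_add lookup_basis E_inject inj_eq)
        qed
        then show "Poly_Mapping.lookup (F (basis (E c d))) u = Poly_Mapping.lookup (F p) u"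
          by (simp add: M_def xy)
      qed
      then have "basis (E c d) = p" using bij by (simp add: bij_def inj_eq)
      then have "Poly_Mapping.lookup (basis (E c d)) (E c d) = Poly_Mapping.lookup p (E c d)" by simp
      moreover have "c \<noteq> d" "d \<noteq> c" using 2 by auto
      ultimately show False using 2(1) by (simp add: p_def lookup_add lookup_basis E_inject)
    qed
  next
    case (3 x)
    then have "\<phi> c \<le> \<phi> x" "\<phi> x \<le> \<phi> d"
      using interval.IH[of c x] interval.IH[of x d] by auto
    then show ?thesis by (rule order_trans)
  qed simp
qed

lemma order_auto_\<phi>: "order_auto \<phi>"
  unfolding order_auto_def bij_def using inj_\<phi> surj_\<phi> \<phi>_mono \<phi>_reflects by blast

text \<open>For arguments that are not intervals \<open>M\<close> has no meaning; the value 0 is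
  what \<open>support\<close> requires there.\<close>

definition coeffs :: "'p \<Rightarrow> 'p \<Rightarrow> 'p \<Rightarrow> 'p \<Rightarrow> 'k" where
  "coeffs a b c d = (if a \<le> b \<and> c \<le> d then M a b (\<phi> c) (\<phi> d) else 0)"

lemma incidence_matrix_coeffs: "incidence_matrix coeffs"
proof
  fix a b c d assume "coeffs a b c d \<noteq> 0"
  then show "a \<le> c \<and> c \<le> d \<and> d \<le> b"
    using M_support[of a b c d] \<phi>_mono[of c d] by (auto simp: coeffs_def split: if_splits)
next
  fix a b c d g :: 'p assume *: "a \<le> c" "c \<le> g" "g \<le> d" "d \<le> b"
  then have ab: "a \<le> g" "g \<le> b" by auto
  then have "a \<le> b" by (rule order_trans)
  have mono: "\<phi> c \<le> \<phi> g" "\<phi> g \<le> \<phi> d" using * by (auto intro: \<phi>_mono)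
  have "M a b (\<phi> c) (\<phi> d) = (\<Sum>x\<in>{a..b}. M a x (\<phi> c) (\<phi> g) * M x b (\<phi> g) (\<phi> d))"
    using comult[of a b "\<phi> c" "\<phi> g" "\<phi> g" "\<phi> d"] \<open>a \<le> b\<close> mono by simp
  \<comment> \<open>A nonzero summand forces \<open>g \<le> x\<close> by its first factor and
    \<open>x \<le> g\<close> by its second, so only \<open>x = g\<close> survives.\<close>
  also have "\<dots> = (\<Sum>x\<in>{a..b}. if x = g then M a g (\<phi> c) (\<phi> g) * M g b (\<phi> g) (\<phi> d) else 0)"
  proof (rule sum.cong[OF refl])
    fix x assume x: "x \<in> {a..b}"
    have "x = g" if "M a x (\<phi> c) (\<phi> g) \<noteq> 0" "M x b (\<phi> g) (\<phi> d) \<noteq> 0"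
      using M_support[OF _ mono(1) that(1)] M_support[OF _ mono(2) that(2)] x
      by (simp add: order.antisym)
    then show "M a x (\<phi> c) (\<phi> g) * M x b (\<phi> g) (\<phi> d) =
      (if x = g then M a g (\<phi> c) (\<phi> g) * M g b (\<phi> g) (\<phi> d) else 0)" by auto
  qed
  also have "\<dots> = M a g (\<phi> c) (\<phi> g) * M g b (\<phi> g) (\<phi> d)"
    using ab finite_interval by simp
  finally show "coeffs a b c d = coeffs a g c g * coeffs g b g d"
    using * ab \<open>a \<le> b\<close> order_trans[OF *(2,3)] by (simp add: coeffs_def)
next
  fix a b :: 'p assume ab: "a \<le> b"
  let ?S = "{c. M a b (\<phi> c) (\<phi> c) \<noteq> 0}"
  \<comment> \<open>The nonzero diagonal coefficients all sit at images of points of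
    \<open>[a, b]\<close>, so this sum becomes the one in \<open>counit\<close> after reindexing
    along \<open>\<phi>\<close>.\<close>
  have "(\<Sum>c\<in>{a..b}. coeffs a b c c) = (\<Sum>c\<in>?S. M a b (\<phi> c) (\<phi> c))"
    using M_diag_support[OF ab] ab finite_interval
    by (intro sum.mono_neutral_cong_right) (auto simp: coeffs_def)
  also have "\<dots> = (\<Sum>e\<in>\<phi> ` ?S. M a b e e)"
    by (simp add: sum.reindex[OF inj_on_subset[OF inj_\<phi>]])
  also have "\<phi> ` ?S = {e. M a b e e \<noteq> 0}"
    using surj_\<phi> by (auto elim: surjE)
  finally show "(\<Sum>c\<in>{a..b}. coeffs a b c c) = (if a = b then 1 else 0)"
    using counit[OF ab] by simp
qed (rule finite_interval)

lemma represents_coeffs: "represents F \<phi> coeffs"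
  using linear order_auto_\<phi> incidence_matrix_coeffs
  by (auto simp: represents_def coeffs_def M_def)

lemma represents_exists:
  "\<exists>\<phi> n. (\<forall>a. F (basis (E a a)) = basis (E (\<phi> a) (\<phi> a))) \<and> represents F \<phi> n"
  using F_point represents_coeffs by blast

end

section \<open>The incidence coalgebra of \<open>X \<times> X\<close>\<close>

lemma sum_interval_prod:
  "(\<Sum>p\<in>{a..b}. f p) = (\<Sum>x\<in>{fst a..fst b}. \<Sum>y\<in>{snd a..snd b}. f (x, y))"
proof -
  have "{a..b} = {fst a..fst b} \<times> {snd a..snd b}" by (auto simp: less_eq_prod_def)
  then show ?thesis by (simp add: sum.cartesian_product)
qed

lemma finite_interval_prod:
  fixes a b :: "'a::order \<times> 'b::order"
  assumes "\<And>a b :: 'a. finite {a..b}" "\<And>a b :: 'b. finite {a..b}"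
  shows "finite {a..b}"
  by (rule finite_subset[of _ "{fst a..fst b} \<times> {snd a..snd b}"])
    (auto simp: less_eq_prod_def assms)

lemma ival_inject: "a \<le> b \<Longrightarrow> c \<le> d \<Longrightarrow> ival a b = ival c d \<longleftrightarrow> a = c \<and> b = d"
  by (metis lo_ival hi_ival)

lemma ival_surj: "\<exists>a b. a \<le> b \<and> i = ival a b"
  using Rep_ival[of i] Rep_ival_inverse[of i] by (auto simp: ival_def intro!: exI)

text \<open>A pair of intervals is an interval of the product poset; this encoding identifies D
  tensor D with the incidence coalgebra of X x X. \<open>ival3\<close> does the same for three
  factors, nested to the right.\<close>

definition ival2 :: "'x::order \<times> 'x \<Rightarrow> 'x \<times> 'x \<Rightarrow> 'x ival \<times> 'x ival" where
  "ival2 p q = (ival (fst p) (fst q), ival (snd p) (snd q))"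

definition ival3 :: "'x::order \<times> 'x \<times> 'x \<Rightarrow> 'x \<times> 'x \<times> 'x \<Rightarrow> 'x ival \<times> 'x ival \<times> 'x ival" where
  "ival3 p q = (ival (fst p) (fst q), ival2 (snd p) (snd q))"

lemma ival2_inject: "p \<le> q \<Longrightarrow> s \<le> t \<Longrightarrow> ival2 p q = ival2 s t \<longleftrightarrow> p = s \<and> q = t"
  by (auto simp: ival2_def less_eq_prod_def ival_inject prod_eq_iff)

lemma interval_basis_ival2:
  assumes "\<And>a b :: 'x::order. finite {a..b}"
  shows "interval_basis (ival2 :: 'x \<times> 'x \<Rightarrow> _)"
proof
  show "finite {a..b}" for a b :: "'x \<times> 'x" by (intro finite_interval_prod assms)
  show "\<exists>a b. a \<le> b \<and> u = ival2 a b" for u :: "'x ival \<times> 'x ival"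
    using ival_surj[of "fst u"] ival_surj[of "snd u"]
    by (force simp: ival2_def less_eq_prod_def prod_eq_iff)
qed (rule ival2_inject)

lemma interval_basis_ival3:
  assumes "\<And>a b :: 'x::order. finite {a..b}"
  shows "interval_basis (ival3 :: 'x \<times> 'x \<times> 'x \<Rightarrow> _)"
proof
  interpret interval_basis "ival2 :: 'x \<times> 'x \<Rightarrow> _" by (intro interval_basis_ival2 assms)
  show "finite {a..b}" for a b :: "'x \<times> 'x \<times> 'x" by (intro finite_interval_prod assms)
  show "a \<le> b \<Longrightarrow> c \<le> d \<Longrightarrow> ival3 a b = ival3 c d \<longleftrightarrow> a = c \<and> b = d" for a b c d :: "'x \<times> 'x \<times> 'x"
    by (auto simp: ival3_def less_eq_prod_def[of a b] less_eq_prod_def[of c d] ival_inject ival2_inject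
      prod_eq_iff[of a c] prod_eq_iff[of b d])
  show "\<exists>a b. a \<le> b \<and> u = ival3 a b" for u :: "'x ival \<times> 'x ival \<times> 'x ival"
    using ival_surj[of "fst u"] E_surj[of "snd u"]
    by (force simp: ival3_def less_eq_prod_def prod_eq_iff)
qed

lemma linear_fscale_sum:
  assumes "Vector_Spaces.linear fscale fscale F"
  shows "F (\<Sum>i\<in>A. f i) = (\<Sum>i\<in>A. F (f i))"
proof -
  interpret Vector_Spaces.linear fscale fscale F by fact
  show ?thesis by (rule sum)
qed

lemma comult_basis:
  assumes "a \<le> b"
  shows "comult (basis (ival a b)) = (\<Sum>c\<in>{a..b}. basis (ival a c, ival c b))"
  using assms by (simp add: comult_def)

lemma linear_comult_sq: "Vector_Spaces.linear fscale fscale (comult_sq \<Delta>)"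
  unfolding comult_sq_def by (intro linear_comp linear_tensor_map linear_lin_ext)

text \<open>Splitting an interval of the product poset at \<open>s\<close> means splitting its
  coordinates at \<open>fst s\<close> and \<open>snd s\<close>; the flip in \<open>comult_sq\<close>
  collects the left and the right halves.\<close>

lemma comult_sq_basis:
  fixes p q :: "'x::order \<times> 'x"
  assumes "p \<le> q"
  shows "comult_sq comult (basis (ival2 p q)) =
    (\<Sum>s\<in>{p..q}. basis (ival2 p s, ival2 s q) :: _ \<Rightarrow>\<^sub>0 'k::field)"
proof (rule poly_mapping_eqI)
  fix uv :: "('x ival \<times> 'x ival) \<times> 'x ival \<times> 'x ival"
  obtain u1 u2 v1 v2 where uv: "uv = ((u1, u2), (v1, v2))" by (metis prod.collapse)
  have swap: "Poly_Mapping.lookup (lin_ext (\<lambda>((b, b'), (c, c')). basis ((b, c), (b', c'))) z)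
      ((u1, u2), (v1, v2)) = Poly_Mapping.lookup z ((u1, v1), (u2, v2))"
    for z :: "('x ival \<times> 'x ival) \<times> 'x ival \<times> 'x ival \<Rightarrow>\<^sub>0 'k"
  proof -
    have "Poly_Mapping.lookup (lin_ext (\<lambda>((b, b'), (c, c')). basis ((b, c), (b', c'))) z)
        ((u1, u2), (v1, v2)) = (\<Sum>y\<in>Poly_Mapping.keys z.
          if y = ((u1, v1), (u2, v2)) then Poly_Mapping.lookup z y else 0)"
      unfolding lookup_lin_ext[OF finite_keys order_refl]
      by (intro sum.cong) (auto simp: lookup_basis split: if_splits)
    then show ?thesis by (simp add: not_in_keys_iff_lookup_eq_zero)
  qed
  have pq: "fst p \<le> fst q" "snd p \<le> snd q" using \<open>p \<le> q\<close> by (auto simp: less_eq_prod_def)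
  have "Poly_Mapping.lookup (comult_sq comult (basis (ival2 p q)) :: _ \<Rightarrow>\<^sub>0 'k) uv =
      Poly_Mapping.lookup (comult (basis (ival (fst p) (fst q)))) (u1, v1) *
      Poly_Mapping.lookup (comult (basis (ival (snd p) (snd q)))) (u2, v2)"
    unfolding uv comult_sq_def comp_def swap ival2_def tensor_map_basis lookup_tensor ..
  also have "\<dots> = (\<Sum>x\<in>{fst p..fst q}. \<Sum>y\<in>{snd p..snd q}.
      Poly_Mapping.lookup (basis (ival (fst p) x, ival x (fst q))) (u1, v1) *
      Poly_Mapping.lookup (basis (ival (snd p) y, ival y (snd q))) (u2, v2))"
    by (simp add: comult_basis pq lookup_sum sum_product)
  also have "\<dots> = Poly_Mapping.lookup (\<Sum>s\<in>{p..q}. basis (ival2 p s, ival2 s q) :: _ \<Rightarrow>\<^sub>0 'k) uv"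
    unfolding lookup_sum sum_interval_prod[of _ p q] uv
    by (intro sum.cong refl) (auto simp: ival2_def lookup_basis)
  finally show "Poly_Mapping.lookup (comult_sq comult (basis (ival2 p q)) :: _ \<Rightarrow>\<^sub>0 'k) uv = \<dots>" .
qed

text \<open>Only the interval \<open>[e, f]\<close>, cut at \<open>g = g'\<close>, yields this basis
  tensor; linearity extends the count from basis elements to \<open>p\<close>.\<close>

lemma lookup_comult_sq:
  fixes e f g g' :: "'x::order \<times> 'x" and p :: "('x, 'k::field) inc2"
  assumes fin: "\<And>a b :: 'x. finite {a..b}" and "e \<le> g" "g' \<le> f"
  shows "Poly_Mapping.lookup (comult_sq comult p) (ival2 e g, ival2 g' f) =
    (if g = g' then Poly_Mapping.lookup p (ival2 e f) else 0)"
proof -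
  interpret interval_basis "ival2 :: 'x \<times> 'x \<Rightarrow> _" by (intro interval_basis_ival2 fin)
  have "Poly_Mapping.lookup (comult_sq comult (basis u)) (ival2 e g, ival2 g' f) =
      (if g = g' \<and> u = ival2 e f then 1 else 0 :: 'k)" for u
  proof -
    obtain a b where ab: "a \<le> b" "u = ival2 a b" using E_surj by blast
    have "Poly_Mapping.lookup (comult_sq comult (basis u)) (ival2 e g, ival2 g' f) =
        (\<Sum>s\<in>{a..b}. if s = g then if g = g' \<and> a = e \<and> b = f then 1 else 0 else 0 :: 'k)"
      unfolding ab(2) comult_sq_basis[OF ab(1)] lookup_sum
    proof (rule sum.cong[OF refl])
      fix s assume "s \<in> {a..b}"
      then have "ival2 a s = ival2 e g \<longleftrightarrow> a = e \<and> s = g" "ival2 s b = ival2 g' f \<longleftrightarrow> s = g' \<and> b = f"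
        using assms(2,3) by (simp_all add: ival2_inject)
      then show "Poly_Mapping.lookup (basis (ival2 a s, ival2 s b)) (ival2 e g, ival2 g' f) =
          (if s = g then if g = g' \<and> a = e \<and> b = f then 1 else 0 else 0 :: 'k)"
        by (auto simp: lookup_basis)
    qed
    also have "\<dots> = (if g = g' \<and> a = e \<and> b = f then 1 else 0)"
      using assms(2,3) by (auto simp: finite_interval)
    also have "(g = g' \<and> a = e \<and> b = f) \<longleftrightarrow> (g = g' \<and> u = ival2 e f)"
    proof (cases "g = g'")
      case True
      then have "e \<le> f" using assms by auto
      then show ?thesis using ab by (simp add: ival2_inject)
    qed simp
    finally show ?thesis .
  qed
  then have "Poly_Mapping.lookup (comult_sq comult p) (ival2 e g, ival2 g' f) =
      (\<Sum>u\<in>Poly_Mapping.keys p. if u = ival2 e f then if g = g' then Poly_Mapping.lookup p u else 0 else 0)"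
    unfolding lookup_linear[OF linear_comult_sq finite_keys[of p] order_refl]
    by (intro sum.cong) auto
  then show ?thesis by (simp add: not_in_keys_iff_lookup_eq_zero)
qed

lemma counit_basis: "counit (basis (ival a b)) = (if a = b then 1 else 0)" if "a \<le> b"
  using that by (simp add: counit_def lin_form_def lookup_basis)

text \<open>The counit sees single points only. The index set is the one in the
  \<open>counit\<close> assumption of \<open>incidence_automorphism\<close>.\<close>

lemma counit_sq_eq:
  fixes p :: "('x::order, 'k::field) inc2"
  assumes fin: "\<And>a b :: 'x. finite {a..b}"
  shows "counit_sq counit p =
    (\<Sum>e | Poly_Mapping.lookup p (ival2 e e) \<noteq> 0. Poly_Mapping.lookup p (ival2 e e))"
proof -
  interpret interval_basis "ival2 :: 'x \<times> 'x \<Rightarrow> _" by (intro interval_basis_ival2 fin)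
  let ?S = "{e. Poly_Mapping.lookup p (ival2 e e) \<noteq> 0}"
  have "counit_sq counit p = (\<Sum>u\<in>Poly_Mapping.keys p.
      if u \<in> (\<lambda>e. ival2 e e) ` ?S then Poly_Mapping.lookup p u else 0)"
    unfolding counit_sq_def lin_form_def
  proof (intro sum.cong refl)
    fix u assume u: "u \<in> Poly_Mapping.keys p"
    obtain a b where ab: "a \<le> b" "u = ival2 a b" using E_surj by blast
    have "u \<in> (\<lambda>e. ival2 e e) ` ?S \<longleftrightarrow> a = b"
      using u ab by (auto simp: ival2_inject in_keys_iff)
    moreover have "fst a \<le> fst b" "snd a \<le> snd b" using ab by (auto simp: less_eq_prod_def)
    ultimately show "Poly_Mapping.lookup p u *
        (case u of (b, c) \<Rightarrow> counit (basis b) * counit (basis c)) =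
        (if u \<in> (\<lambda>e. ival2 e e) ` ?S then Poly_Mapping.lookup p u else 0)"
      by (auto simp: ab(2) ival2_def counit_basis prod_eq_iff)
  qed
  also have "\<dots> = (\<Sum>u\<in>(\<lambda>e. ival2 e e) ` ?S. Poly_Mapping.lookup p u)"
    by (subst sum.inter_restrict[symmetric]) (auto intro!: sum.cong simp: in_keys_iff)
  also have "\<dots> = (\<Sum>e\<in>?S. Poly_Mapping.lookup p (ival2 e e))"
    by (subst sum.reindex) (auto simp: inj_on_def ival2_inject)
  finally show ?thesis .
qed

lemma incidence_automorphism_ival2:
  fixes r :: "('x::order, 'k::field) inc2 \<Rightarrow> ('x, 'k) inc2"
  assumes fin: "\<And>a b :: 'x. finite {a..b}"
    and r: "coalgebra_automorphism (comult_sq comult) (counit_sq counit) r"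
  shows "incidence_automorphism ival2 r"
proof -
  interpret interval_basis "ival2 :: 'x \<times> 'x \<Rightarrow> _" by (intro interval_basis_ival2 fin)
  have lin: "Vector_Spaces.linear fscale fscale r" and bij: "bij r"
    and com: "tensor_map r r \<circ> comult_sq comult = comult_sq comult \<circ> r"
    and cou: "counit_sq counit \<circ> r = counit_sq counit"
    using r by (auto simp: coalgebra_automorphism_def linear_iso_def)
  have "(\<Sum>c\<in>{a..b}. Poly_Mapping.lookup (r (basis (ival2 a c))) (ival2 e g) *
      Poly_Mapping.lookup (r (basis (ival2 c b))) (ival2 g' f)) =
      (if g = g' then Poly_Mapping.lookup (r (basis (ival2 a b))) (ival2 e f) else 0)"
    if "a \<le> b" "e \<le> g" "g' \<le> f" for a b e f g g'
  proof -
    have "Poly_Mapping.lookup (tensor_map r r (comult_sq comult (basis (ival2 a b))))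
        (ival2 e g, ival2 g' f) = (\<Sum>c\<in>{a..b}. Poly_Mapping.lookup (r (basis (ival2 a c))) (ival2 e g) *
          Poly_Mapping.lookup (r (basis (ival2 c b))) (ival2 g' f))"
      by (simp add: comult_sq_basis[OF that(1)] linear_fscale_sum[OF linear_tensor_map]
        lookup_sum tensor_map_basis lookup_tensor)
    also have "tensor_map r r (comult_sq comult (basis (ival2 a b))) =
        comult_sq comult (r (basis (ival2 a b)))"
      using com by (simp add: fun_eq_iff)
    finally show ?thesis by (simp add: lookup_comult_sq[OF fin that(2,3)])
  qed
  moreover have "(\<Sum>e | Poly_Mapping.lookup (r (basis (ival2 a b))) (ival2 e e) \<noteq> 0.
      Poly_Mapping.lookup (r (basis (ival2 a b))) (ival2 e e)) = (if a = b then 1 else 0)"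
    if "a \<le> b" for a b
  proof -
    have "counit_sq counit (r (basis (ival2 a b))) = counit_sq counit (basis (ival2 a b))"
      using cou by (simp add: fun_eq_iff)
    also have "\<dots> = (if a = b then 1 else 0)"
      using that by (auto simp: counit_sq_def lin_form_def lookup_basis ival2_def counit_basis
        less_eq_prod_def prod_eq_iff)
    finally show ?thesis by (simp add: counit_sq_eq[OF fin])
  qed
  ultimately show ?thesis
    using lin bij interval_basis_axioms
    by (simp add: incidence_automorphism_def incidence_automorphism_axioms_def)
qed

section \<open>The braid equation in coordinates\<close>

text \<open>The image under \<open>s\<close> of a covering pair \<open>(a, b) < (a', b)\<close> is a covering pair, so it varies
  in one coordinate only, and injectivity of \<open>\<lambda>a. snd (s (a, b))\<close> forces that to be the second.\<close>

lemma fst_const: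
  fixes s :: "'x::order \<times> 'x \<Rightarrow> 'x \<times> 'x"
  assumes fin: "\<And>a b :: 'x. finite {a..b}"
    and s: "order_auto s" "set_nondegenerate s" and "a \<le> a'"
  shows "fst (s (a, b)) = fst (s (a', b))"
  using fin \<open>a \<le> a'\<close>
proof (induction rule: interval_induct)
  case (interval a a')
  consider "a = a'" | "a < a'" "\<And>x. \<not> (a < x \<and> x < a')" | x where "a < x" "x < a'"
    using interval.hyps by force
  then show ?case
  proof cases
    case 2
    obtain p q p' q' where pq: "s (a, b) = (p, q)" "s (a', b) = (p', q')" by fastforce
    note mono = order_auto_le_iff[OF s(1)]
    have "(p, q) \<le> (p', q')" using mono[of "(a, b)" "(a', b)"] pq 2 by simp
    then have le: "p \<le> p'" "q \<le> q'" by auto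
    have "inj (\<lambda>a. snd (s (a, b)))" using s(2) by (simp add: set_nondegenerate_def bij_def)
    then have "q \<noteq> q'" using 2 pq by (auto dest!: injD[of _ a a'])
    \<comment> \<open>\<open>(p, q')\<close> is a corner of the rectangle between the two image
      points. Its preimage \<open>u\<close> lies between \<open>(a, b)\<close> and
      \<open>(a', b)\<close>, hence is one of them; \<open>q \<noteq> q'\<close> rules out the
      first, and the second gives \<open>p = p'\<close>.\<close>
    obtain u where u: "s u = (p, q')" using s(1) by (metis order_auto_def bij_pointE)
    have "(a, b) \<le> u" "u \<le> (a', b)"
      using mono[of "(a, b)" u] mono[of u "(a', b)"] u pq le by simp_all
    then have u': "a \<le> fst u" "fst u \<le> a'" "snd u = b"
      by (cases u; auto)+
    then have "fst u = a \<or> fst u = a'" using 2(2)[of "fst u"] by auto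
    then have "u = (a, b) \<or> u = (a', b)" using u' by (metis prod.collapse)
    then show ?thesis using u pq \<open>q \<noteq> q'\<close> by auto
  next
    case (3 x)
    then have "fst (s (a, b)) = fst (s (x, b))" "fst (s (x, b)) = fst (s (a', b))"
      using interval.IH[of a x] interval.IH[of x a'] by auto
    then show ?thesis by simp
  qed simp
qed

text \<open>Apply \<open>fst_const\<close> to the conjugate of \<open>s\<close> by the coordinate
  swap, which interchanges the two conditions of \<open>set_nondegenerate\<close>.\<close>

lemma snd_const:
  fixes s :: "'x::order \<times> 'x \<Rightarrow> 'x \<times> 'x"
  assumes fin: "\<And>a b :: 'x. finite {a..b}"
    and s: "order_auto s" "set_nondegenerate s" and "b \<le> b'"
  shows "snd (s (a, b)) = snd (s (a, b'))"
proof -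
  have *: "bij (prod.swap :: 'x \<times> 'x \<Rightarrow> _)" by (simp add: bij_swap)
  have "order_auto (prod.swap \<circ> s \<circ> prod.swap)"
    using s(1) * by (auto simp: order_auto_def less_eq_prod_def intro!: bij_comp)
  moreover have "set_nondegenerate (prod.swap \<circ> s \<circ> prod.swap)"
    using s(2) by (simp add: set_nondegenerate_def)
  ultimately show ?thesis using fst_const[OF fin, of "prod.swap \<circ> s \<circ> prod.swap" b b' a] \<open>b \<le> b'\<close>
    by simp
qed

section \<open>Tensoring an incidence matrix with the identity\<close>

text \<open>The third coordinate carries the matrix of the identity, 1 at equal intervals. The
  condition \<open>e \<le> f\<close> makes it 0 at pairs that are not intervals, as
  \<open>support\<close> demands.\<close>

fun tensor_id_right ::
    "('x \<times> 'x \<Rightarrow> 'x \<times> 'x \<Rightarrow> 'x \<times> 'x \<Rightarrow> 'x \<times> 'x \<Rightarrow> 'k::field) \<Rightarrow>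
     'x::order \<times> 'x \<times> 'x \<Rightarrow> 'x \<times> 'x \<times> 'x \<Rightarrow> 'x \<times> 'x \<times> 'x \<Rightarrow> 'x \<times> 'x \<times> 'x \<Rightarrow> 'k" where
  "tensor_id_right n (a, c, e) (b, d, f) (g, i, k) (h, j, l) =
     (if e = k \<and> f = l \<and> e \<le> f then n (a, c) (b, d) (g, i) (h, j) else 0)"

fun tensor_id_left ::
    "('x \<times> 'x \<Rightarrow> 'x \<times> 'x \<Rightarrow> 'x \<times> 'x \<Rightarrow> 'x \<times> 'x \<Rightarrow> 'k::field) \<Rightarrow>
     'x::order \<times> 'x \<times> 'x \<Rightarrow> 'x \<times> 'x \<times> 'x \<Rightarrow> 'x \<times> 'x \<times> 'x \<Rightarrow> 'x \<times> 'x \<times> 'x \<Rightarrow> 'k" where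
  "tensor_id_left n (a, c, e) (b, d, f) (g, i, k) (h, j, l) =
     (if a = g \<and> b = h \<and> a \<le> b then n (c, e) (d, f) (i, k) (j, l) else 0)"

lemma sum_interval_triple:
  "(\<Sum>p\<in>{(a, c, e)..(b, d, f)}. F p) = (\<Sum>x\<in>{a..b}. \<Sum>w\<in>{c..d}. \<Sum>u\<in>{e..f}. F (x, w, u))"
  by (simp add: sum_interval_prod)

context
  fixes n :: "'x::order \<times> 'x \<Rightarrow> 'x \<times> 'x \<Rightarrow> 'x \<times> 'x \<Rightarrow> 'x \<times> 'x \<Rightarrow> 'k::field"
  assumes fin: "\<And>a b :: 'x. finite {a..b}"
begin

text \<open>Of the intermediate intervals in the third coordinate only \<open>[e, f]\<close>
  survives; the premises place \<open>u = e\<close> and \<open>v = f\<close> inside the summation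
  ranges.\<close>

lemma star_tensor_id_right:
  assumes "e \<le> f" "e \<le> k" "l \<le> f"
  shows "star (tensor_id_right n) m (a, c, e) (b, d, f) (g, i, k) (h, j, l) =
    (\<Sum>x\<in>{a..g}. \<Sum>w\<in>{c..i}. \<Sum>y\<in>{h..b}. \<Sum>z\<in>{j..d}.
      n (a, c) (b, d) (x, w) (y, z) * m (x, w, e) (y, z, f) (g, i, k) (h, j, l))"
  unfolding star_def sum_interval_triple
proof (rule sum.cong[OF refl], rule sum.cong[OF refl])
  fix x w
  have "(\<Sum>u\<in>{e..k}. \<Sum>y\<in>{h..b}. \<Sum>z\<in>{j..d}. \<Sum>v\<in>{l..f}.
      tensor_id_right n (a, c, e) (b, d, f) (x, w, u) (y, z, v) *
        m (x, w, u) (y, z, v) (g, i, k) (h, j, l)) =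
      (\<Sum>u\<in>{e..k}. if u = e then \<Sum>y\<in>{h..b}. \<Sum>z\<in>{j..d}. \<Sum>v\<in>{l..f}. if v = f then
        n (a, c) (b, d) (x, w) (y, z) * m (x, w, e) (y, z, f) (g, i, k) (h, j, l) else 0 else 0)"
    using assms by (intro sum.cong refl) (auto intro!: sum.cong sum.neutral)
  then show "(\<Sum>u\<in>{e..k}. \<Sum>y\<in>{h..b}. \<Sum>z\<in>{j..d}. \<Sum>v\<in>{l..f}.
      tensor_id_right n (a, c, e) (b, d, f) (x, w, u) (y, z, v) *
        m (x, w, u) (y, z, v) (g, i, k) (h, j, l)) =
      (\<Sum>y\<in>{h..b}. \<Sum>z\<in>{j..d}.
        n (a, c) (b, d) (x, w) (y, z) * m (x, w, e) (y, z, f) (g, i, k) (h, j, l))"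
    using assms by (simp add: fin)
qed

lemma star_tensor_id_left:
  assumes "a \<le> b" "a \<le> g" "h \<le> b"
  shows "star (tensor_id_left n) m (a, c, e) (b, d, f) (g, i, k) (h, j, l) =
    (\<Sum>w\<in>{c..i}. \<Sum>u\<in>{e..k}. \<Sum>z\<in>{j..d}. \<Sum>v\<in>{l..f}.
      n (c, e) (d, f) (w, u) (z, v) * m (a, w, u) (b, z, v) (g, i, k) (h, j, l))"
proof -
  have "star (tensor_id_left n) m (a, c, e) (b, d, f) (g, i, k) (h, j, l) =
      (\<Sum>x\<in>{a..g}. if x = a then \<Sum>w\<in>{c..i}. \<Sum>u\<in>{e..k}. \<Sum>y\<in>{h..b}. if y = b then
        \<Sum>z\<in>{j..d}. \<Sum>v\<in>{l..f}.
        n (c, e) (d, f) (w, u) (z, v) * m (a, w, u) (b, z, v) (g, i, k) (h, j, l) else 0 else 0)"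
    unfolding star_def sum_interval_triple
    using assms by (intro sum.cong refl) (auto intro!: sum.cong sum.neutral)
  then show ?thesis using assms by (simp add: fin)
qed

lemma incidence_matrix_tensor_id_right:
  assumes "incidence_matrix n"
  shows "incidence_matrix (tensor_id_right n)"
proof
  interpret n: incidence_matrix n by fact
  fix t t' s s' p :: "'x \<times> 'x \<times> 'x"
  obtain a c e b d f where t: "t = (a, c, e)" "t' = (b, d, f)" by (metis prod.collapse)
  show "finite {t..t'}" by (intro finite_interval_prod fin)
  show "(\<Sum>s\<in>{t..t'}. tensor_id_right n t t' s s) = (if t = t' then 1 else 0)" if le: "t \<le> t'"
  \<comment> \<open>If \<open>e \<noteq> f\<close>, the identity factor has no coefficient at a
    single point, since that point would equal both ends.\<close>
  proof (cases "e = f")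
    case True
    then have "(\<Sum>s\<in>{t..t'}. tensor_id_right n t t' s s) = (\<Sum>s\<in>{(a, c)..(b, d)}. n (a, c) (b, d) s s)"
      by (simp add: t sum_interval_prod)
    also have "\<dots> = (if (a, c) = (b, d) then 1 else 0)" using le by (intro n.counit) (auto simp: t)
    finally show ?thesis using True by (simp add: t)
  next
    case False
    have "tensor_id_right n t t' s s = 0" for s
      using False by (cases s) (auto simp: t)
    then show ?thesis using False by (simp add: t)
  qed
  obtain g i k h j l where s: "s = (g, i, k)" "s' = (h, j, l)" by (metis prod.collapse)
  show "t \<le> s \<and> s \<le> s' \<and> s' \<le> t'" if "tensor_id_right n t t' s s' \<noteq> 0"
    using that n.support[of "(a, c)" "(b, d)" "(g, i)" "(h, j)"]
    by (auto simp: t s split: if_splits)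
  obtain x y z where p: "p = (x, y, z)" by (metis prod.collapse)
  show "tensor_id_right n t t' s s' = tensor_id_right n t p s p * tensor_id_right n p t' p s'"
    if le: "t \<le> s" "s \<le> p" "p \<le> s'" "s' \<le> t'"
  proof -
    have "n (a, c) (b, d) (g, i) (h, j) =
        n (a, c) (x, y) (g, i) (x, y) * n (x, y) (b, d) (x, y) (h, j)"
      using le by (intro n.split) (auto simp: t s p)
    moreover have "e \<le> z" "z \<le> f" "e \<le> f" using le by (auto simp: t s p)
    ultimately show ?thesis by (simp add: t s p)
  qed
qed

lemma incidence_matrix_tensor_id_left:
  assumes "incidence_matrix n"
  shows "incidence_matrix (tensor_id_left n)"
proof
  interpret n: incidence_matrix n by fact
  fix t t' s s' p :: "'x \<times> 'x \<times> 'x"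
  obtain a c e b d f where t: "t = (a, c, e)" "t' = (b, d, f)" by (metis prod.collapse)
  show "finite {t..t'}" by (intro finite_interval_prod fin)
  show "(\<Sum>s\<in>{t..t'}. tensor_id_left n t t' s s) = (if t = t' then 1 else 0)" if le: "t \<le> t'"
  proof (cases "a = b")
    case True
    then have "(\<Sum>s\<in>{t..t'}. tensor_id_left n t t' s s) = (\<Sum>s\<in>{(c, e)..(d, f)}. n (c, e) (d, f) s s)"
      by (simp add: t sum_interval_prod)
    also have "\<dots> = (if (c, e) = (d, f) then 1 else 0)" using le by (intro n.counit) (auto simp: t)
    finally show ?thesis using True by (simp add: t)
  next
    case False
    have "tensor_id_left n t t' s s = 0" for s
      using False by (cases s) (auto simp: t)
    then show ?thesis using False by (simp add: t)
  qed
  obtain g i k h j l where s: "s = (g, i, k)" "s' = (h, j, l)" by (metis prod.collapse)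
  show "t \<le> s \<and> s \<le> s' \<and> s' \<le> t'" if "tensor_id_left n t t' s s' \<noteq> 0"
    using that n.support[of "(c, e)" "(d, f)" "(i, k)" "(j, l)"]
    by (auto simp: t s split: if_splits)
  obtain x y z where p: "p = (x, y, z)" by (metis prod.collapse)
  show "tensor_id_left n t t' s s' = tensor_id_left n t p s p * tensor_id_left n p t' p s'"
    if le: "t \<le> s" "s \<le> p" "p \<le> s'" "s' \<le> t'"
  proof -
    have "n (c, e) (d, f) (i, k) (j, l) =
        n (c, e) (y, z) (i, k) (y, z) * n (y, z) (d, f) (y, z) (j, l)"
      using le by (intro n.split) (auto simp: t s p)
    moreover have "a \<le> x" "x \<le> b" "a \<le> b" using le by (auto simp: t s p)
    ultimately show ?thesis by (simp add: t s p)
  qed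
qed

lemma represents_r12:
  assumes "interval_basis.represents ival2 r \<phi> n"
  shows "interval_basis.represents ival3 (r12 r) (set_r12 \<phi>) (tensor_id_right n)"
proof -
  interpret E2: interval_basis "ival2 :: 'x \<times> 'x \<Rightarrow> _" by (intro interval_basis_ival2 fin)
  interpret E3: interval_basis "ival3 :: 'x \<times> 'x \<times> 'x \<Rightarrow> _" by (intro interval_basis_ival3 fin)
  have r: "Vector_Spaces.linear fscale fscale r" "order_auto \<phi>" "incidence_matrix n"
    "\<And>a b c d. a \<le> b \<Longrightarrow> c \<le> d \<Longrightarrow>
      Poly_Mapping.lookup (r (basis (ival2 a b))) (ival2 (\<phi> c) (\<phi> d)) = n a b c d"
    using assms by (auto simp: E2.represents_def)
  note mono = order_auto_le_iff[OF r(2)]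
  have bij: "bij \<phi>" using r(2) by (simp add: order_auto_def)
  have "bij (set_r12 \<phi>)"
  proof (rule bijI)
    show "inj (set_r12 \<phi>)"
    proof (rule injI)
      fix t t' assume eq: "set_r12 \<phi> t = set_r12 \<phi> t'"
      obtain a b c a' b' c' where t: "t = (a, b, c)" "t' = (a', b', c')" by (metis prod.collapse)
      have "\<phi> (a, b) = \<phi> (a', b')" "c = c'"
        using eq by (simp_all add: t set_r12_def prod_eq_iff)
      then show "t = t'" using bij by (simp add: t bij_def inj_eq)
    qed
    show "surj (set_r12 \<phi>)"
    proof (rule surjI)
      fix t
      show "set_r12 \<phi> (case t of (a, b, c) \<Rightarrow> (fst (inv \<phi> (a, b)), snd (inv \<phi> (a, b)), c)) = t"
        using bij by (cases t) (simp add: set_r12_def bij_def surj_f_inv_f)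
    qed
  qed
  moreover have "set_r12 \<phi> t \<le> set_r12 \<phi> t' \<longleftrightarrow> t \<le> t'" for t t'
    using mono[of "(fst t, fst (snd t))" "(fst t', fst (snd t'))"]
    by (simp add: set_r12_def less_eq_prod_def split_beta) blast
  ultimately have "order_auto (set_r12 \<phi>)" by (simp add: order_auto_def)
  moreover have "Poly_Mapping.lookup (r12 r (basis (ival3 t t'))) (ival3 (set_r12 \<phi> s) (set_r12 \<phi> s')) =
      tensor_id_right n t t' s s'" if "t \<le> t'" "s \<le> s'" for t t' s s'
  proof -
    obtain a c e b d f g i k h j l where *: "t = (a, c, e)" "t' = (b, d, f)"
      "s = (g, i, k)" "s' = (h, j, l)" by (metis prod.collapse)
    have "(a, c) \<le> (b, d)" "(g, i) \<le> (h, j)" "e \<le> f" "k \<le> l" using that by (auto simp: *)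
    then show ?thesis using r(4)[of "(a, c)" "(b, d)" "(g, i)" "(h, j)"]
      by (simp add: * set_r12_def ival3_def ival2_def lookup_r12 ival_inject)
  qed
  ultimately show ?thesis
    using incidence_matrix_tensor_id_right[OF r(3)] by (simp add: E3.represents_def linear_r12)
qed

lemma represents_r23:
  assumes "interval_basis.represents ival2 r \<phi> n"
  shows "interval_basis.represents ival3 (r23 r) (set_r23 \<phi>) (tensor_id_left n)"
proof -
  interpret E2: interval_basis "ival2 :: 'x \<times> 'x \<Rightarrow> _" by (intro interval_basis_ival2 fin)
  interpret E3: interval_basis "ival3 :: 'x \<times> 'x \<times> 'x \<Rightarrow> _" by (intro interval_basis_ival3 fin)
  have r: "Vector_Spaces.linear fscale fscale r" "order_auto \<phi>" "incidence_matrix n"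
    "\<And>a b c d. a \<le> b \<Longrightarrow> c \<le> d \<Longrightarrow>
      Poly_Mapping.lookup (r (basis (ival2 a b))) (ival2 (\<phi> c) (\<phi> d)) = n a b c d"
    using assms by (auto simp: E2.represents_def)
  note mono = order_auto_le_iff[OF r(2)]
  have bij: "bij \<phi>" using r(2) by (simp add: order_auto_def)
  have "bij (set_r23 \<phi>)"
  proof (rule bijI)
    show "inj (set_r23 \<phi>)"
    proof (rule injI)
      fix t t' assume eq: "set_r23 \<phi> t = set_r23 \<phi> t'"
      then have "\<phi> (snd t) = \<phi> (snd t')" "fst t = fst t'"
        by (simp_all add: set_r23_def split_beta)
      then show "t = t'" using bij by (auto simp: bij_def inj_eq intro: prod_eqI)
    qed
    show "surj (set_r23 \<phi>)"
    proof (rule surjI)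
      fix t
      show "set_r23 \<phi> (case t of (a, p) \<Rightarrow> (a, inv \<phi> p)) = t"
        using bij by (cases t) (simp add: set_r23_def bij_def surj_f_inv_f)
    qed
  qed
  moreover have "set_r23 \<phi> t \<le> set_r23 \<phi> t' \<longleftrightarrow> t \<le> t'" for t t'
    using mono[of "snd t" "snd t'"] by (simp add: set_r23_def less_eq_prod_def[of _ t'] split_beta)
  ultimately have "order_auto (set_r23 \<phi>)" by (simp add: order_auto_def)
  moreover have "Poly_Mapping.lookup (r23 r (basis (ival3 t t'))) (ival3 (set_r23 \<phi> s) (set_r23 \<phi> s')) =
      tensor_id_left n t t' s s'" if "t \<le> t'" "s \<le> s'" for t t' s s'
  proof -
    obtain a c e b d f g i k h j l where *: "t = (a, c, e)" "t' = (b, d, f)"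
      "s = (g, i, k)" "s' = (h, j, l)" by (metis prod.collapse)
    have "(c, e) \<le> (d, f)" "(i, k) \<le> (j, l)" "a \<le> b" "g \<le> h" using that by (auto simp: *)
    then show ?thesis using r(4)[of "(c, e)" "(d, f)" "(i, k)" "(j, l)"]
      by (simp add: * set_r23_def ival3_def ival2_def lookup_r23 ival_inject)
  qed
  ultimately show ?thesis
    using incidence_matrix_tensor_id_left[OF r(3)] by (simp add: E3.represents_def linear_r23)
qed

end

section \<open>\<open>LBE\<close> and \<open>RBE\<close> as coefficients of the two sides of the
  braid equation\<close>

declare LBE.simps [simp del] RBE.simps [simp del]

text \<open>The assumption \<open>r0\<close> identifies the order automorphism that represents
  \<open>r\<close> with the map behind \<open>lact\<close> and \<open>ract\<close>, which thereby
  become monotone.\<close>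

locale represented_braiding =
  fixes r :: "('x::order, 'k::field) inc2 \<Rightarrow> ('x, 'k) inc2" and \<phi> n
  assumes fin: "\<And>a b :: 'x. finite {a..b}"
    and rep: "interval_basis.represents ival2 r \<phi> n"
    and r0: "r0 r = \<phi>"
    and nondeg: "set_nondegenerate \<phi>"
    and braid: "set_braid_solution \<phi>"
begin

sublocale E2: interval_basis "ival2 :: 'x \<times> 'x \<Rightarrow> _"
  by (intro interval_basis_ival2 fin)

sublocale E3: interval_basis "ival3 :: 'x \<times> 'x \<times> 'x \<Rightarrow> _"
  by (intro interval_basis_ival3 fin)

abbreviation L :: "'x \<Rightarrow> 'x \<Rightarrow> 'x" where "L \<equiv> lact r"
abbreviation R :: "'x \<Rightarrow> 'x \<Rightarrow> 'x" where "R \<equiv> ract r"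

lemma order_auto_\<phi>: "order_auto \<phi>"
  using rep by (simp add: E2.represents_def)

lemma \<phi>_eq: "\<phi> (a, b) = (L a b, R a b)"
  by (simp add: lact_def ract_def r0)

lemma set_r12_eq: "set_r12 \<phi> (a, b, c) = (L a b, R a b, c)"
  by (simp add: set_r12_def \<phi>_eq)

lemma set_r23_eq: "set_r23 \<phi> (a, b, c) = (a, L b c, R b c)"
  by (simp add: set_r23_def \<phi>_eq)

lemma L_mono: "a \<le> a' \<Longrightarrow> b \<le> b' \<Longrightarrow> L a b \<le> L a' b'"
  and R_mono: "a \<le> a' \<Longrightarrow> b \<le> b' \<Longrightarrow> R a b \<le> R a' b'"
  using order_auto_le_iff[OF order_auto_\<phi>, of "(a, b)" "(a', b')"] by (auto simp: \<phi>_eq)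

text \<open>Oriented so that rewriting moves the acting element towards the lower ends, which
  \<open>LBE\<close> and \<open>RBE\<close> mostly use.\<close>

lemma L_const: "a \<le> a' \<Longrightarrow> L a' b = L a b"
  using fst_const[OF fin order_auto_\<phi> nondeg, of a a' b] by (simp add: \<phi>_eq)

lemma R_const: "b \<le> b' \<Longrightarrow> R a b' = R a b"
  using snd_const[OF fin order_auto_\<phi> nondeg, of b b' a] by (simp add: \<phi>_eq)

lemma L_inj: "L a b = L a b' \<longleftrightarrow> b = b'"
  using nondeg by (auto simp: set_nondegenerate_def \<phi>_eq bij_def dest: injD)

lemma R_inj: "R a b = R a' b \<longleftrightarrow> a = a'"
  using nondeg by (auto simp: set_nondegenerate_def \<phi>_eq bij_def dest: injD)

lemma braid_LRL:
  "L (L g i) (L (R g i) k) = L g (L i k)"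
  "R (L g i) (L (R g i) k) = L (R g (L i k)) (R i k)"
  "R (R g i) k = R (R g (L i k)) (R i k)"
  using fun_cong[OF braid[unfolded set_braid_solution_def], of "(g, i, k)"]
  by (simp_all add: set_r12_eq set_r23_eq)

text \<open>Links the coordinates of the representation to \<open>coef\<close>; monotonicity of the
  actions makes the target pairs intervals, so the dummy value of \<open>coef\<close> does not
  arise.\<close>

lemma n_eq_coef:
  assumes "a \<le> b" "c \<le> d" "g \<le> h" "i \<le> j"
  shows "n (a, c) (b, d) (g, i) (h, j) = coef r a b c d (L g i) (L h j) (R g i) (R h j)"
proof -
  have "n (a, c) (b, d) (g, i) (h, j) =
      Poly_Mapping.lookup (r (basis (ival2 (a, c) (b, d)))) (ival2 (\<phi> (g, i)) (\<phi> (h, j)))"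
    using rep assms by (simp add: E2.represents_def)
  then show ?thesis using assms by (simp add: coef_def \<phi>_eq ival2_def L_mono R_mono)
qed

lemmas star_right = star_tensor_id_right[OF fin] and star_left = star_tensor_id_left[OF fin]

text \<open>The nesting follows \<open>represents_comp\<close>: everything after the first factor is
  pulled back along the set map of that factor.\<close>

definition "LM = star (tensor_id_right n) (pullback (set_r12 \<phi>)
  (star (tensor_id_left n) (pullback (set_r23 \<phi>) (tensor_id_right n))))"

definition "RM = star (tensor_id_left n) (pullback (set_r23 \<phi>)
  (star (tensor_id_right n) (pullback (set_r12 \<phi>) (tensor_id_left n))))"

text \<open>The three factors of a summand are the coefficients of the three maps applied in turn.
  The identity factor of the last map determines the intermediate ends \<open>w'\<close> and
  \<open>z'\<close>, which leaves six sums; constancy of the actions and the braid relation of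
  \<open>\<phi>\<close> bring the arguments into the form used in \<open>LBE\<close>.\<close>

lemma LM_eq_LBE:
  assumes "(a, c, e) \<le> (g, i, k)" "(g, i, k) \<le> (h, j, l)" "(h, j, l) \<le> (b, d, f)"
  shows "LM (a, c, e) (b, d, f) (g, i, k) (h, j, l) = LBE r (g, i, k) (h, j, l) (a, c, e) (b, d, f)"
proof -
  have ord: "a \<le> g" "g \<le> h" "h \<le> b" "c \<le> i" "i \<le> j" "j \<le> d" "e \<le> k" "k \<le> l" "l \<le> f"
    using assms by auto
  then have "e \<le> f" "c \<le> j" "a \<le> h" "e \<le> l" by auto
  define T where "T x y w z u v =
        coef r a b c d (L a w) (L a z) (R x c) (R y c) *
        coef r (R x c) (R y c) e f
          (L (R x c) u) (L (R x c) v) (R (R g c) e) (R (R h c) e) *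
        coef r (L a w) (L a z) (L (R x c) u) (L (R x c) v)
          (L a (L c k)) (L a (L c l)) (R (L a i) (L (R a i) e)) (R (L a j) (L (R a j) e))"
    for x y w z u v
  have "LM (a, c, e) (b, d, f) (g, i, k) (h, j, l) =
      (\<Sum>x\<in>{a..g}. \<Sum>w\<in>{c..i}. \<Sum>y\<in>{h..b}. \<Sum>z\<in>{j..d}. \<Sum>u\<in>{e..k}. \<Sum>v\<in>{l..f}. T x y w z u v)"
    unfolding LM_def star_right[OF \<open>e \<le> f\<close> \<open>e \<le> k\<close> \<open>l \<le> f\<close>]
  proof (rule sum.cong[OF refl], rule sum.cong[OF refl], rule sum.cong[OF refl], rule sum.cong[OF refl])
    fix x w y z
    assume "x \<in> {a..g}" "w \<in> {c..i}" "y \<in> {h..b}" "z \<in> {j..d}"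
    then have o: "a \<le> x" "x \<le> g" "c \<le> w" "w \<le> i" "h \<le> y" "y \<le> b" "j \<le> z" "z \<le> d"
      by auto
    then have o': "x \<le> y" "w \<le> z" "a \<le> y" "c \<le> z" using ord by (meson order_trans)+
    have LL: "L x w = L a w" "L y z = L a z" "L g i = L a i" "L h j = L a j"
      using o o' ord \<open>a \<le> h\<close> by (simp_all add: L_const)
    have RR: "R x w = R x c" "R y z = R y c" "R g i = R g c" "R h j = R h c"
      using o o' ord \<open>c \<le> j\<close> by (simp_all add: R_const)
    have mn: "L a w \<le> L a z" "L a w \<le> L a i" "L a j \<le> L a z" "R x c \<le> R g c" "R h c \<le> R y c"
      "R g c \<le> R h c" "R x c \<le> R y c" "R x c \<le> R h c"
      using o o' ord by (auto intro!: L_mono R_mono)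
    \<comment> \<open>The last map is the identity on the third coordinate, so \<open>R w' u\<close>
      and \<open>R (R g c) k\<close> must agree; since \<open>u \<le> k\<close>, constancy and
      injectivity of the action turn this into \<open>w' = R g c\<close>, and likewise
      \<open>z' = R h c\<close>.\<close>
    have pb: "pullback (set_r23 \<phi>) (tensor_id_right n)
          (L a w, w', u) (L a z, z', v) (L a i, R g c, k) (L a j, R h c, l) =
        (if w' = R g c then if z' = R h c then
          coef r (L a w) (L a z) (L (R x c) u) (L (R x c) v)
            (L a (L c k)) (L a (L c l)) (R (L a i) (L (R a i) e)) (R (L a j) (L (R a j) e)) else 0 else 0)"
      if "u \<in> {e..k}" "v \<in> {l..f}" for w' u z' v
    proof -
      have uv: "e \<le> u" "u \<le> k" "l \<le> v" "v \<le> f" "u \<le> v" "e \<le> v" using that ord by auto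
      have eqs: "R w' u = R (R g c) k \<longleftrightarrow> w' = R g c" "R z' v = R (R h c) l \<longleftrightarrow> z' = R h c"
        using uv R_const[of u k w', symmetric] R_const[of l v z'] by (simp_all add: R_inj)
      have le: "R (R g c) u \<le> R (R h c) v" using mn(6) uv(5) by (rule R_mono)
      have L1: "L (R g c) u = L (R x c) u" "L (R h c) v = L (R x c) v"
        using mn by (simp_all add: L_const)
      \<comment> \<open>The first component of the braid relation at \<open>(g, i, k)\<close> and
        \<open>(h, j, l)\<close>, with the acting elements lowered to \<open>a\<close> and
        \<open>c\<close>.\<close>
      have L2: "L (L a i) (L (R g c) k) = L a (L c k)" "L (L a j) (L (R h c) l) = L a (L c l)"
        using braid_LRL(1)[of g i k] braid_LRL(1)[of h j l] ord \<open>a \<le> h\<close> \<open>c \<le> j\<close> LL RR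
          L_const[of a g] L_const[of c i] L_const[of a h] L_const[of c j] by simp_all
      \<comment> \<open>The two acting elements are values of \<open>L\<close> at comparable
        arguments, hence comparable, so \<open>R_const\<close> applies.\<close>
      have "R (L a i) (L (R g c) k) = R (L a i) (L (R a i) e)"
      proof -
        have "R a i \<le> R g c" using R_mono[of a g c c] R_const[of c i a] ord by simp
        then have "L (R a i) e \<le> L (R g c) k" using ord by (intro L_mono)
        then show ?thesis by (rule R_const)
      qed
      moreover have "R (L a j) (L (R h c) l) = R (L a j) (L (R a j) e)"
      proof -
        have "R a j \<le> R h c" using R_mono[of a h c c] R_const[of c j a] \<open>a \<le> h\<close> \<open>c \<le> j\<close> by simp
        then have "L (R a j) e \<le> L (R h c) l" using \<open>e \<le> l\<close> by (intro L_mono)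
        then show ?thesis by (rule R_const)
      qed
      moreover have "n (L a w, L (R x c) u) (L a z, L (R x c) v) (L a i, L (R g c) k) (L a j, L (R h c) l) =
          coef r (L a w) (L a z) (L (R x c) u) (L (R x c) v)
            (L (L a i) (L (R g c) k)) (L (L a j) (L (R h c) l))
            (R (L a i) (L (R g c) k)) (R (L a j) (L (R h c) l))"
        by (rule n_eq_coef[OF mn(1) L_mono[OF order_refl uv(5)] L_mono[OF order_refl ord(5)]
          L_mono[OF mn(6) ord(8)]])
      ultimately show ?thesis
        using eqs le L1 L2 by (simp add: pullback_def set_r23_eq)
    qed
    have "pullback (set_r12 \<phi>) (star (tensor_id_left n) (pullback (set_r23 \<phi>) (tensor_id_right n)))
        (x, w, e) (y, z, f) (g, i, k) (h, j, l) =
      (\<Sum>w'\<in>{R x c..R g c}. \<Sum>u\<in>{e..k}. \<Sum>z'\<in>{R h c..R y c}. \<Sum>v\<in>{l..f}.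
        n (R x c, e) (R y c, f) (w', u) (z', v) *
        pullback (set_r23 \<phi>) (tensor_id_right n)
          (L a w, w', u) (L a z, z', v) (L a i, R g c, k) (L a j, R h c, l))"
      unfolding pullback_def[of "set_r12 \<phi>"] set_r12_eq LL RR star_left[OF mn(1-3)] ..
    also have "\<dots> = (\<Sum>w'\<in>{R x c..R g c}. if w' = R g c then
        \<Sum>u\<in>{e..k}. \<Sum>z'\<in>{R h c..R y c}. if z' = R h c then \<Sum>v\<in>{l..f}.
        n (R x c, e) (R y c, f) (R g c, u) (R h c, v) *
        coef r (L a w) (L a z) (L (R x c) u) (L (R x c) v)
            (L a (L c k)) (L a (L c l)) (R (L a i) (L (R a i) e)) (R (L a j) (L (R a j) e)) else 0 else 0)"
      by (intro sum.cong refl) (auto simp: pb intro!: sum.cong sum.neutral)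
    also have "\<dots> = (\<Sum>u\<in>{e..k}. \<Sum>v\<in>{l..f}.
        n (R x c, e) (R y c, f) (R g c, u) (R h c, v) *
        coef r (L a w) (L a z) (L (R x c) u) (L (R x c) v)
            (L a (L c k)) (L a (L c l)) (R (L a i) (L (R a i) e)) (R (L a j) (L (R a j) e)))"
      using mn by (simp add: fin)
    finally have inner: "pullback (set_r12 \<phi>) (star (tensor_id_left n) (pullback (set_r23 \<phi>) (tensor_id_right n)))
        (x, w, e) (y, z, f) (g, i, k) (h, j, l) = \<dots>" .
    have outer: "n (a, c) (b, d) (x, w) (y, z) = coef r a b c d (L a w) (L a z) (R x c) (R y c)"
      using n_eq_coef[of a b c d x y w z] o o' LL RR by (auto dest: order_trans)
    have middle: "n (R x c, e) (R y c, f) (R g c, u) (R h c, v) =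
        coef r (R x c) (R y c) e f
          (L (R x c) u) (L (R x c) v) (R (R g c) e) (R (R h c) e)"
      if "u \<in> {e..k}" "v \<in> {l..f}" for u v
    proof -
      have uv: "e \<le> u" "u \<le> k" "l \<le> v" "v \<le> f" "u \<le> v" "e \<le> v" using that ord by auto
      have "L (R g c) u = L (R x c) u" "L (R h c) v = L (R x c) v"
        "R (R g c) u = R (R g c) e" "R (R h c) v = R (R h c) e"
        using L_const[OF mn(4)] L_const[OF mn(8)] R_const[OF uv(1)] R_const[OF uv(6)] by auto
      then show ?thesis
        using n_eq_coef[of "R x c" "R y c" e f "R g c" "R h c" u v] mn uv \<open>e \<le> f\<close> by simp
    qed
    show "n (a, c) (b, d) (x, w) (y, z) *
      pullback (set_r12 \<phi>) (star (tensor_id_left n) (pullback (set_r23 \<phi>) (tensor_id_right n)))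
        (x, w, e) (y, z, f) (g, i, k) (h, j, l) = (\<Sum>u\<in>{e..k}. \<Sum>v\<in>{l..f}. T x y w z u v)"
      unfolding inner outer sum_distrib_left
      by (intro sum.cong refl) (simp add: middle T_def mult_ac)
  qed
  \<comment> \<open>Only the sums over \<open>w\<close> and \<open>y\<close> stand in a different
    order.\<close>
  also have "\<dots> = LBE r (g, i, k) (h, j, l) (a, c, e) (b, d, f)"
    unfolding LBE.simps Let_def T_def by (rule sum.cong[OF refl], rule sum.swap)
  finally show ?thesis .
qed

text \<open>The same scheme with the outer coordinates exchanged: the last map is now the identity
  on the first coordinate, which determines the intermediate ends \<open>i'\<close> and
  \<open>j'\<close> through injectivity of \<open>L\<close>.\<close>

lemma RM_eq_RBE:
  assumes "(a, c, e) \<le> (g, i, k)" "(g, i, k) \<le> (h, j, l)" "(h, j, l) \<le> (b, d, f)"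
  shows "RM (a, c, e) (b, d, f) (g, i, k) (h, j, l) = RBE r (g, i, k) (h, j, l) (a, c, e) (b, d, f)"
proof -
  have ord: "a \<le> g" "g \<le> h" "h \<le> b" "c \<le> i" "i \<le> j" "j \<le> d" "e \<le> k" "k \<le> l" "l \<le> f"
    using assms by auto
  then have "a \<le> b" "c \<le> j" "a \<le> h" "e \<le> l" by auto
  define T where "T x y w z u v =
        coef r c d e f (L c u) (L c v) (R w e) (R z e) *
        coef r a b (L c u) (L c v)
          (L a (L c k)) (L a (L c l)) (R x (L c u)) (R y (L c u)) *
        coef r (R x (L c u)) (R y (L c u)) (R w e) (R z e)
          (L (R a (L i e)) (R i e)) (L (R a (L j e)) (R j e)) (R (R g c) e) (R (R h c) e)"
    for x y w z u v
  have "RM (a, c, e) (b, d, f) (g, i, k) (h, j, l) =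
      (\<Sum>w\<in>{c..i}. \<Sum>u\<in>{e..k}. \<Sum>z\<in>{j..d}. \<Sum>v\<in>{l..f}. \<Sum>x\<in>{a..g}. \<Sum>y\<in>{h..b}. T x y w z u v)"
    unfolding RM_def star_left[OF \<open>a \<le> b\<close> \<open>a \<le> g\<close> \<open>h \<le> b\<close>]
  proof (rule sum.cong[OF refl], rule sum.cong[OF refl], rule sum.cong[OF refl], rule sum.cong[OF refl])
    fix w u z v
    assume "w \<in> {c..i}" "u \<in> {e..k}" "z \<in> {j..d}" "v \<in> {l..f}"
    then have o: "c \<le> w" "w \<le> i" "e \<le> u" "u \<le> k" "j \<le> z" "z \<le> d" "l \<le> v" "v \<le> f"
      by auto
    then have o': "w \<le> z" "u \<le> v" "c \<le> z" "e \<le> v" using ord by (meson order_trans)+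
    have LL: "L w u = L c u" "L z v = L c v" "L i k = L c k" "L j l = L c l"
      using o o' ord \<open>c \<le> j\<close> by (simp_all add: L_const)
    have RR: "R w u = R w e" "R z v = R z e" "R i k = R i e" "R j l = R j e"
      using o o' ord \<open>e \<le> l\<close> by (simp_all add: R_const)
    have mn: "R w e \<le> R z e" "R w e \<le> R i e" "R j e \<le> R z e" "L c u \<le> L c k" "L c l \<le> L c v"
      "L c k \<le> L c l" "L c u \<le> L c v" "L c u \<le> L c l" "R i e \<le> R j e"
      using o o' ord by (auto intro!: L_mono R_mono)
    \<comment> \<open>The target of the last factor. The last two equations come from the third
      component of the braid relation; \<open>R a (L i e)\<close> and \<open>R a (L j e)\<close> are
      the \<open>p\<close> and \<open>q\<close> of \<open>RBE\<close>.\<close>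
    have ends: "L (R g (L c k)) (R i e) = L (R a (L i e)) (R i e)"
      "L (R h (L c l)) (R j e) = L (R a (L j e)) (R j e)"
      "R (R g (L c k)) (R i e) = R (R g c) e" "R (R h (L c l)) (R j e) = R (R h c) e"
    proof -
      have p: "R a (L i e) = R a (L c k)" and q: "R a (L j e) = R a (L c l)"
        using R_const[of "L i e" "L c k" a] R_const[of "L j e" "L c l" a]
          L_mono[of c c e k] L_mono[of c c e l] L_const[of c i e] L_const[of c j e]
          ord \<open>c \<le> j\<close> \<open>e \<le> l\<close> by simp_all
      show "L (R g (L c k)) (R i e) = L (R a (L i e)) (R i e)"
        unfolding p using \<open>a \<le> g\<close> by (intro L_const R_mono order_refl)
      show "L (R h (L c l)) (R j e) = L (R a (L j e)) (R j e)"
        unfolding q using \<open>a \<le> h\<close> by (intro L_const R_mono order_refl)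
      have "R g c = R g i" "R h c = R h j" "R (R g i) e = R (R g i) k" "R (R h j) e = R (R h j) l"
        using R_const[of c i g] R_const[of c j h] R_const[of e k "R g i"] R_const[of e l "R h j"]
          ord \<open>c \<le> j\<close> \<open>e \<le> l\<close> by simp_all
      then show "R (R g (L c k)) (R i e) = R (R g c) e" "R (R h (L c l)) (R j e) = R (R h c) e"
        using braid_LRL(3)[of g i k] braid_LRL(3)[of h j l] LL RR by simp_all
    qed
    have pb: "pullback (set_r12 \<phi>) (tensor_id_left n)
          (x, i', R w e) (y, j', R z e) (g, L c k, R i e) (h, L c l, R j e) =
        (if i' = L c k then if j' = L c l then
          coef r (R x (L c u)) (R y (L c u)) (R w e) (R z e)
          (L (R a (L i e)) (R i e)) (L (R a (L j e)) (R j e)) (R (R g c) e) (R (R h c) e) else 0 else 0)"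
      if "x \<in> {a..g}" "y \<in> {h..b}" for x i' y j'
    proof -
      have xy: "a \<le> x" "x \<le> g" "h \<le> y" "y \<le> b" "x \<le> y" "x \<le> h" using that ord by auto
      have eqs: "L x i' = L g (L c k) \<longleftrightarrow> i' = L c k" "L y j' = L h (L c l) \<longleftrightarrow> j' = L c l"
        using xy L_const[of x g "L c k"] L_const[of h y j'] by (simp_all add: L_inj)
      have le: "L x (L c k) \<le> L y (L c l)" using xy(5) mn(6) by (rule L_mono)
      have R1: "R x (L c k) = R x (L c u)" "R y (L c l) = R y (L c u)"
        using mn by (simp_all add: R_const)
      have "n (R x (L c u), R w e) (R y (L c u), R z e) (R g (L c k), R i e) (R h (L c l), R j e) =
          coef r (R x (L c u)) (R y (L c u)) (R w e) (R z e)
            (L (R g (L c k)) (R i e)) (L (R h (L c l)) (R j e))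
            (R (R g (L c k)) (R i e)) (R (R h (L c l)) (R j e))"
        by (rule n_eq_coef[OF R_mono[OF xy(5) order_refl] mn(1) R_mono[OF ord(2) mn(6)] mn(9)])
      then show ?thesis
        using eqs le R1 ends by (simp add: pullback_def set_r12_eq)
    qed
    have "pullback (set_r23 \<phi>) (star (tensor_id_right n) (pullback (set_r12 \<phi>) (tensor_id_left n)))
        (a, w, u) (b, z, v) (g, i, k) (h, j, l) =
      (\<Sum>x\<in>{a..g}. \<Sum>i'\<in>{L c u..L c k}. \<Sum>y\<in>{h..b}. \<Sum>j'\<in>{L c l..L c v}.
        n (a, L c u) (b, L c v) (x, i') (y, j') *
        pullback (set_r12 \<phi>) (tensor_id_left n)
          (x, i', R w e) (y, j', R z e) (g, L c k, R i e) (h, L c l, R j e))"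
      unfolding pullback_def[of "set_r23 \<phi>"] set_r23_eq LL RR star_right[OF mn(1-3)] ..
    also have "\<dots> = (\<Sum>x\<in>{a..g}. \<Sum>i'\<in>{L c u..L c k}. if i' = L c k then
        \<Sum>y\<in>{h..b}. \<Sum>j'\<in>{L c l..L c v}. if j' = L c l then
        n (a, L c u) (b, L c v) (x, L c k) (y, L c l) *
        coef r (R x (L c u)) (R y (L c u)) (R w e) (R z e)
          (L (R a (L i e)) (R i e)) (L (R a (L j e)) (R j e)) (R (R g c) e) (R (R h c) e) else 0 else 0)"
      by (intro sum.cong refl) (auto simp: pb intro!: sum.cong sum.neutral)
    also have "\<dots> = (\<Sum>x\<in>{a..g}. \<Sum>y\<in>{h..b}.
        n (a, L c u) (b, L c v) (x, L c k) (y, L c l) *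
        coef r (R x (L c u)) (R y (L c u)) (R w e) (R z e)
          (L (R a (L i e)) (R i e)) (L (R a (L j e)) (R j e)) (R (R g c) e) (R (R h c) e))"
      using mn by (simp add: fin)
    finally have inner: "pullback (set_r23 \<phi>) (star (tensor_id_right n) (pullback (set_r12 \<phi>) (tensor_id_left n)))
        (a, w, u) (b, z, v) (g, i, k) (h, j, l) = \<dots>" .
    have "c \<le> d" "e \<le> f" using ord by auto
    then have outer: "n (c, e) (d, f) (w, u) (z, v) = coef r c d e f (L c u) (L c v) (R w e) (R z e)"
      using n_eq_coef[of c d e f w z u v] o' LL RR by simp
    have middle: "n (a, L c u) (b, L c v) (x, L c k) (y, L c l) =
        coef r a b (L c u) (L c v) (L a (L c k)) (L a (L c l)) (R x (L c u)) (R y (L c u))"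
      if "x \<in> {a..g}" "y \<in> {h..b}" for x y
    proof -
      have xy: "a \<le> x" "x \<le> y" "a \<le> y" using that ord by auto
      have "L x (L c k) = L a (L c k)" "L y (L c l) = L a (L c l)"
        "R x (L c k) = R x (L c u)" "R y (L c l) = R y (L c u)"
        using mn xy by (simp_all add: L_const R_const)
      then show ?thesis
        using n_eq_coef[of a b "L c u" "L c v" x y "L c k" "L c l"] mn xy \<open>a \<le> b\<close> by simp
    qed
    show "n (c, e) (d, f) (w, u) (z, v) *
      pullback (set_r23 \<phi>) (star (tensor_id_right n) (pullback (set_r12 \<phi>) (tensor_id_left n)))
        (a, w, u) (b, z, v) (g, i, k) (h, j, l) = (\<Sum>x\<in>{a..g}. \<Sum>y\<in>{h..b}. T x y w z u v)"
      unfolding inner outer sum_distrib_left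
      by (intro sum.cong refl) (simp add: middle T_def mult_ac)
  qed
  also have "\<dots> = (\<Sum>(w, u, z, v, x, y)\<in>{c..i} \<times> {e..k} \<times> {j..d} \<times> {l..f} \<times> {a..g} \<times> {h..b}. T x y w z u v)"
    by (simp add: sum.cartesian_product)
  also have "\<dots> = (\<Sum>(x, y, w, z, u, v)\<in>{a..g} \<times> {h..b} \<times> {c..i} \<times> {j..d} \<times> {e..k} \<times> {l..f}. T x y w z u v)"
    by (rule sum.reindex_bij_witness[where i = "\<lambda>(x, y, w, z, u, v). (w, u, z, v, x, y)"
      and j = "\<lambda>(w, u, z, v, x, y). (x, y, w, z, u, v)"]) auto
  also have "\<dots> = RBE r (g, i, k) (h, j, l) (a, c, e) (b, d, f)"
    unfolding RBE.simps Let_def T_def by (simp add: sum.cartesian_product)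
  finally show ?thesis .
qed

lemma represents_LM:
  "E3.represents (r12 r \<circ> r23 r \<circ> r12 r) (set_r12 \<phi> \<circ> set_r23 \<phi> \<circ> set_r12 \<phi>) LM"
  unfolding LM_def
  by (intro E3.represents_comp represents_r12 represents_r23 fin rep)

lemma represents_RM:
  "E3.represents (r23 r \<circ> r12 r \<circ> r23 r) (set_r23 \<phi> \<circ> set_r12 \<phi> \<circ> set_r23 \<phi>) RM"
  unfolding RM_def
  by (intro E3.represents_comp represents_r12 represents_r23 fin rep)

text \<open>As \<open>\<phi>\<close> solves the set-theoretic braid equation, both sides move points
  by the same order automorphism, and \<open>represents_eq_iff\<close> applies.\<close>

lemma braid_solution_iff: "braid_solution r \<longleftrightarrow> LM = RM"
  unfolding braid_solution_def
  using E3.represents_eq_iff[OF represents_LM] represents_RM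
  by (simp add: braid[unfolded set_braid_solution_def])

lemma LBE_eq_RBE_iff:
  assumes "t \<le> s" "s \<le> s'" "s' \<le> t'"
  shows "LBE r s s' t t' = RBE r s s' t t' \<longleftrightarrow> LM t t' s s' = RM t t' s s'"
  using assms LM_eq_LBE RM_eq_RBE by (cases s; cases s'; cases t; cases t') simp

end


section \<open>Heights\<close>

text \<open>A strictly increasing chain is injective, so the size of \<open>P\<close> bounds its
  height; this makes the maximum in \<open>height\<close> meaningful.\<close>

lemma finite_chain_lengths:
  assumes "finite (P :: 'p::order set)"
  shows "finite {n. \<exists>c :: nat \<Rightarrow> 'p. (\<forall>i\<le>n. c i \<in> P) \<and> (\<forall>i<n. c i < c (Suc i))}"
proof (rule finite_subset)
  show "{n. \<exists>c :: nat \<Rightarrow> 'p. (\<forall>i\<le>n. c i \<in> P) \<and> (\<forall>i<n. c i < c (Suc i))} \<subseteq> {..card P}"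
  proof
    fix n assume "n \<in> {n. \<exists>c :: nat \<Rightarrow> 'p. (\<forall>i\<le>n. c i \<in> P) \<and> (\<forall>i<n. c i < c (Suc i))}"
    then obtain c :: "nat \<Rightarrow> 'p" where c: "\<forall>i\<le>n. c i \<in> P" "\<forall>i<n. c i < c (Suc i)" by blast
    have less: "c i < c j" if "i < j" "j \<le> n" for i j
      using that
    proof (induction j)
      case (Suc j)
      then have "c j < c (Suc j)" using c(2) by simp
      moreover have "c i \<le> c j" using Suc by (cases "i = j") auto
      ultimately show ?case by simp
    qed simp
    have "inj_on c {..n}"
    proof (rule inj_onI)
      fix i j assume "i \<in> {..n}" "j \<in> {..n}" "c i = c j"
      then show "i = j" using less[of i j] less[of j i] by (cases i j rule: linorder_cases) auto
    qed
    then have "card {..n} \<le> card P"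
      using c(1) assms by (intro card_inj_on_le) auto
    then show "n \<in> {..card P}" by simp
  qed
qed simp

lemma height_ge_1:
  fixes a b :: "'p::order"
  assumes "finite {a..b}" "a < b"
  shows "height {a..b} \<ge> 1"
  unfolding height_def
proof (rule Max_ge[OF finite_chain_lengths[OF assms(1)]])
  show "1 \<in> {n. \<exists>c :: nat \<Rightarrow> 'p. (\<forall>i\<le>n. c i \<in> {a..b}) \<and> (\<forall>i<n. c i < c (Suc i))}"
    using assms(2) by (auto intro!: exI[of _ "\<lambda>i. if i = 0 then a else b"])
qed

lemma height_cover:
  fixes a b :: "'p::order"
  assumes "finite {a..b}" "a < b" and cover: "\<And>c. \<not> (a < c \<and> c < b)"
  shows "height {a..b} = 1"
proof (rule antisym[OF _ height_ge_1[OF assms(1,2)]])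
  let ?H = "{n. \<exists>c :: nat \<Rightarrow> 'p. (\<forall>i\<le>n. c i \<in> {a..b}) \<and> (\<forall>i<n. c i < c (Suc i))}"
  \<comment> \<open>With a nonempty set of lengths the maximum is attained by a chain
    \<open>c\<close>; a height above 1 would put \<open>c 1\<close> strictly between
    \<open>a\<close> and \<open>b\<close>.\<close>
  have "0 \<in> ?H" using assms(2) by auto
  then have "height {a..b} \<in> ?H"
    unfolding height_def using Max_in[OF finite_chain_lengths[OF assms(1)]] by blast
  then obtain c where c: "\<And>i. i \<le> height {a..b} \<Longrightarrow> c i \<in> {a..b}"
    "\<And>i. i < height {a..b} \<Longrightarrow> c i < c (Suc i)" by blast
  show "height {a..b} \<le> 1"
  proof (rule ccontr)
    assume "\<not> height {a..b} \<le> 1"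
    then have "a \<le> c 0" "c 0 < c 1" "c 1 < c 2" "c 2 \<le> b"
      using c(1)[of 0] c(1)[of 2] c(2)[of 0] c(2)[of 1] by (auto simp: numeral_2_eq_2)
    then show False using cover[of "c 1"] by auto
  qed
qed

section \<open>Reduction of the braid equation to the tested inclusions\<close>

theorem corollary2p5:
  fixes r :: "('x::order, 'k::field) inc2 \<Rightarrow> ('x, 'k) inc2"
  assumes locally_finite: "\<And>a b :: 'x. finite {a..b}"
    and automorphism: "coalgebra_automorphism (comult_sq comult) (counit_sq counit) r"
    and nondeg: "nondegenerate r"
    and set_nondeg: "set_nondegenerate (r0 r)"
    and set_braid: "set_braid_solution (r0 r)"
  shows "braid_solution r \<longleftrightarrow>
    (\<forall>s s' t t' :: 'x \<times> 'x \<times> 'x.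
       s \<le> s' \<longrightarrow> t \<le> t' \<longrightarrow> {s..s'} \<subseteq> {t..t'} \<longrightarrow>
       (lower_extremal s s' t t' \<and> height {t..t'} \<ge> 1 \<or>
        {s..s'} = {t..t'} \<and> height {t..t'} = 1) \<longrightarrow>
       LBE r s s' t t' = RBE r s s' t t')"
proof -
  obtain \<phi> n where point: "\<And>p. r (basis (ival2 p p)) = basis (ival2 (\<phi> p) (\<phi> p))"
    and rep: "interval_basis.represents ival2 r \<phi> n"
    using incidence_automorphism.represents_exists
      [OF incidence_automorphism_ival2[OF locally_finite automorphism]] by blast
  have pt: "pt p = (basis (ival2 p p) :: ('x, 'k) inc2)" for p :: "'x \<times> 'x"
    by (simp add: pt_def ival2_def)
  \<comment> \<open>Distinct points give distinct basis elements, so the definite description in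
    \<open>r0\<close> denotes \<open>\<phi> p\<close>.\<close>
  have "r0 r p = \<phi> p" for p
    unfolding r0_def pt point
  proof (rule the_equality)
    fix q assume "basis (ival2 (\<phi> p) (\<phi> p)) = (basis (ival2 q q) :: ('x, 'k) inc2)"
    then have "ival2 (\<phi> p) (\<phi> p) = ival2 q q" by (metis keys_basis singleton_inject)
    then show "q = \<phi> p" by (simp add: ival2_inject)
  qed simp
  then have r0: "r0 r = \<phi>" by (rule ext)
  interpret represented_braiding r \<phi> n
    using locally_finite rep r0 set_nondeg set_braid by unfold_locales auto
  interpret LM: incidence_matrix LM using represents_LM by (simp add: E3.represents_def)
  have RM: "incidence_matrix RM" using represents_RM by (simp add: E3.represents_def)
  show ?thesis
    unfolding braid_solution_iff
  proof (intro iffI allI impI)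
    fix s s' t t' :: "'x \<times> 'x \<times> 'x"
    assume "LM = RM" "s \<le> s'" "{s..s'} \<subseteq> {t..t'}"
    then show "LBE r s s' t t' = RBE r s s' t t'"
      by (subst LBE_eq_RBE_iff) auto
  next
    assume *: "\<forall>s s' t t' :: 'x \<times> 'x \<times> 'x.
       s \<le> s' \<longrightarrow> t \<le> t' \<longrightarrow> {s..s'} \<subseteq> {t..t'} \<longrightarrow>
       (lower_extremal s s' t t' \<and> height {t..t'} \<ge> 1 \<or>
        {s..s'} = {t..t'} \<and> height {t..t'} = 1) \<longrightarrow>
       LBE r s s' t t' = RBE r s s' t t'"
    show "LM = RM"
    \<comment> \<open>Both premises of \<open>rigid\<close> are among the tested inclusions: for
      \<open>t < t'\<close> the least point is lower extremal in an interval of height at least 1,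
      and a covering pair spans an interval of height 1, taken with S = T.\<close>
    proof (rule LM.rigid[OF RM])
      fix t t' :: "'x \<times> 'x \<times> 'x" assume "t < t'"
      then have "LBE r t t t t' = RBE r t t t t'"
        using *[rule_format, of t t t t'] height_ge_1[OF E3.finite_interval, of t t']
        by (simp add: lower_extremal_def)
      then show "LM t t' t t = RM t t' t t" using \<open>t < t'\<close> by (simp add: LBE_eq_RBE_iff)
      assume "\<And>c. \<not> (t < c \<and> c < t')"
      then have "LBE r t t' t t' = RBE r t t' t t'"
        using *[rule_format, of t t' t t'] height_cover[OF E3.finite_interval, of t t'] \<open>t < t'\<close>
        by simp
      then show "LM t t' t t' = RM t t' t t'" using \<open>t < t'\<close> by (simp add: LBE_eq_RBE_iff)
    qed
  qed
qed

end
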